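(* Let $r\ge 3$ and $2\le k\le r-1$ be integers, and let $G$ be a $k$-tightly connected $r$-graph which is not $r$-partite. Then $$r(G,K_n^r)\ge 2^{\Omega\left(n^{(r-1)/\binom rk}\right)},$$ that is, there exist a constant $c>0$ and $n_1\in\mathbb N$ such that $r(G,K_n^r)\ge 2^{\,c\,n^{(r-1)/\binom rk}}$ for all $n\ge n_1$.
   Context: All hypergraphs are finite. An $r$-graph ($r$-uniform hypergraph) $H$ consists of a vertex set $V(H)$ and a set $E(H)$ of $r$-element subsets of $V(H)$. For $1\le k\le r-1$, an $r$-graph $H$ is $k$-tightly connected if its edges can be ordered as $e_1,\ldots,e_t$ so that for every $i\ge 2$ there is some $j<i$ with $|e_i\cap e_j|\ge k$. An $r$-graph $G$ is $r$-partite if its vertex set can be partitioned into $r$ (possibly empty) parts so that every edge contains exactly one vertex from each part. $K_n^r$ denotes the complete $r$-graph on $n$ vertices. The Ramsey number $r(G,K_n^r)$ is the smallest integer $N$ such that every $r$-graph on $N$ vertices contains either a (not necessarily induced) copy of $G$ or an independent set of size $n$ (a set of $n$ vertices containing no edge); equivalently, every red/blue colouring of the edges of $K_N^r$ contains a red copy of $G$ or a blue copy of $K_n^r$. *)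

theory Defs
  imports Complex_Main "HOL-Library.Ramsey" "HOL-Library.Disjoint_Sets"
begin

definition r_graph :: "nat \<Rightarrow> 'a set \<Rightarrow> 'a set set \<Rightarrow> bool" where
  "r_graph r V E \<longleftrightarrow> finite V \<and> E \<subseteq> [V]\<^bsup>r\<^esup>"

text \<open>Only the edges matter here: isolated vertices do not affect tight connectivity.\<close>

definition tightly_connected :: "nat \<Rightarrow> 'a set set \<Rightarrow> bool" where
  "tightly_connected k E \<longleftrightarrow>
     (\<exists>es. distinct es \<and> set es = E \<and>
        (\<forall>i. 1 \<le> i \<and> i < length es \<longrightarrow> (\<exists>j<i. k \<le> card (es ! i \<inter> es ! j))))"

definition r_partite :: "nat \<Rightarrow> 'a set \<Rightarrow> 'a set set \<Rightarrow> bool" where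
  "r_partite r V E \<longleftrightarrow>
     (\<exists>P :: nat \<Rightarrow> 'a set. disjoint_family_on P {..<r} \<and> (\<Union>i<r. P i) = V \<and>
        (\<forall>e\<in>E. \<forall>i<r. card (e \<inter> P i) = 1))"

definition contains_copy :: "'b set \<Rightarrow> 'b set set \<Rightarrow> 'a set \<Rightarrow> 'a set set \<Rightarrow> bool" where
  "contains_copy V E VG EG \<longleftrightarrow>
     (\<exists>f. inj_on f VG \<and> f ` VG \<subseteq> V \<and> (\<forall>e\<in>EG. f ` e \<in> E))"

definition independent_set :: "'a set \<Rightarrow> 'a set set \<Rightarrow> 'a set \<Rightarrow> bool" where
  "independent_set V E S \<longleftrightarrow> S \<subseteq> V \<and> (\<forall>e\<in>E. \<not> e \<subseteq> S)"

definition ramsey_property ::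
    "nat \<Rightarrow> 'a set \<Rightarrow> 'a set set \<Rightarrow> nat \<Rightarrow> nat \<Rightarrow> bool" where
  "ramsey_property r VG EG n N \<longleftrightarrow>
     (\<forall>(V :: nat set) E. r_graph r V E \<and> card V = N \<longrightarrow>
        contains_copy V E VG EG \<or> (\<exists>S. independent_set V E S \<and> card S = n))"

text \<open>The number \<open>r(G, K\<^sub>n\<^sup>r)\<close>. The minimum is over a nonempty set when \<open>G\<close> is an
  \<open>r\<close>-graph, see \<open>ramsey_property_ex\<close> below.\<close>

definition ramsey_number :: "nat \<Rightarrow> 'a set \<Rightarrow> 'a set set \<Rightarrow> nat \<Rightarrow> nat" where
  "ramsey_number r VG EG n = (LEAST N. ramsey_property r VG EG n N)"

lemma ramsey_property_ex:
  fixes VG :: "'a set"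
  assumes G: "r_graph r VG EG"
  shows "\<exists>N. ramsey_property r VG EG n N"
proof -
  obtain N :: nat where N: "partn_lst {..<N} [card VG, n] r"
    using ramsey_full by blast
  have "contains_copy V E VG EG \<or> (\<exists>S. independent_set V E S \<and> card S = n)"
    if H: "r_graph r V E" and cV: "card V = N" for V :: "nat set" and E
  proof -
    have fV: "finite V" and EV: "E \<subseteq> [V]\<^bsup>r\<^esup>"
      using H by (auto simp: r_graph_def)
    obtain h where h: "bij_betw h {..<N} V"
      using ex_bij_betw_nat_finite[OF fV] cV unfolding atLeast0LessThan by blast
    define col where "col = (\<lambda>X. if h ` X \<in> E then 0 else 1 :: nat)"
    have "col \<in> [{..<N}]\<^bsup>r\<^esup> \<rightarrow> {..<length [card VG, n]}"
      by (auto simp: col_def)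
    then obtain i where i: "i < 2" and mono: "monochromatic {..<N} ([card VG, n] ! i) r col i"
      using N unfolding partn_lst_def by (auto simp: numeral_2_eq_2 dest!: bspec[where x = col])
    then obtain X where X: "X \<subseteq> {..<N}" "finite X" "card X = [card VG, n] ! i"
      and Xcol: "\<And>Y. Y \<in> [X]\<^bsup>r\<^esup> \<Longrightarrow> col Y = i"
      unfolding monochromatic_def nsets_def by (auto simp: image_subset_iff)
    have inj: "inj_on h X"
      using h X(1) by (meson bij_betw_def inj_on_subset)
    have hX: "h ` X \<subseteq> V"
      using h X(1) by (auto simp: bij_betw_def)
    consider "i = 0" | "i = 1" using i by linarith
    then show ?thesis
    proof cases
      case 1
      then have "card VG = card X" using X by simp
      then obtain g where g: "bij_betw g VG X"
        using finite_same_card_bij[of VG X] G X(2) unfolding r_graph_def by blast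
      have "(h \<circ> g) ` e \<in> E" if "e \<in> EG" for e
      proof -
        have e: "e \<subseteq> VG" "finite e" "card e = r"
          using G that by (auto simp: r_graph_def nsets_def)
        have "inj_on g e"
          using g e(1) by (meson bij_betw_def inj_on_subset)
        then have "g ` e \<in> [X]\<^bsup>r\<^esup>"
          using e g by (auto simp: nsets_def card_image bij_betw_def)
        then have "col (g ` e) = 0" using Xcol 1 by simp
        then show ?thesis by (auto simp: col_def image_comp split: if_splits)
      qed
      moreover have "inj_on (h \<circ> g) VG"
        using g inj by (auto simp: bij_betw_def comp_inj_on)
      moreover have "(h \<circ> g) ` VG \<subseteq> V"
        using g hX by (auto simp: bij_betw_def)
      ultimately show ?thesis
        unfolding contains_copy_def by blast
    next
      case 2
      have "\<not> e \<subseteq> h ` X" if "e \<in> E" for e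
      proof
        assume "e \<subseteq> h ` X"
        then obtain Y where Y: "Y \<subseteq> X" "e = h ` Y" by (auto simp: subset_image_iff)
        have "card Y = r"
          using EV that Y card_image[OF inj_on_subset[OF inj Y(1)]] by (auto simp: nsets_def)
        then have "Y \<in> [X]\<^bsup>r\<^esup>"
          using Y X(2) by (auto simp: nsets_def finite_subset)
        then have "col Y = 1" using Xcol 2 by simp
        then show False using that Y by (simp add: col_def)
      qed
      moreover have "card (h ` X) = n"
        using X 2 inj by (simp add: card_image)
      ultimately show ?thesis
        using hX unfolding independent_set_def by blast
    qed
  qed
  then show ?thesis unfolding ramsey_property_def by blast
qed

end

theory Submission
  imports Defs
begin

text \<open>
  A lower bound on the Ramsey number requires an \<open>r\<close>-graph \<open>H\<close> on \<open>N\<close> vertices without a copy of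
  \<open>G\<close> and without an independent set of size \<open>n\<close>. A copy of a \<open>k\<close>-tightly connected \<open>G\<close> lies in
  one \<open>k\<close>-tight component of \<open>H\<close>, so if all these components are \<open>r\<close>-partite and \<open>G\<close> is not, there
  is no copy. Such an \<open>H\<close> comes from \<open>m\<close> colourings \<open>\<chi> i\<close> of the vertices with \<open>r\<close> colours and a
  labelling \<open>\<phi>\<close> of the \<open>k\<close>-sets of vertices with labels below \<open>m\<close>: an \<open>r\<close>-set is an edge if for
  some \<open>i\<close> all its \<open>k\<close>-subsets have label \<open>i\<close> and \<open>\<chi> i\<close> takes every colour on it once. Edges
  sharing \<open>k\<close> vertices then have the same \<open>i\<close>, so a tight component is partitioned by a single
  \<open>\<chi> i\<close>; this is \<open>copy_in_labelled_edges_r_partite\<close>.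

  It remains to choose \<open>\<chi>\<close> and \<open>\<phi>\<close> so that \<open>n\<close>-sets are not independent, with \<open>log N\<close> as large
  as a constant times \<open>m\<close>. For random colourings every \<open>r\<close>-set is rainbow for a constant fraction of
  the colourings (\<open>rainbow_colourings_exist_linear\<close>). For a random labelling, an \<open>n\<close>-set spans about
  \<open>n ^ r / m ^ (r choose k)\<close> edges of each label in expectation. If \<open>m\<close> has order
  \<open>n powr ((r - 1) / (r choose k))\<close>, this is of order \<open>n\<close>, and since \<open>(s choose k) / (s - 1)\<close>
  does not decrease with \<open>s\<close>, overlapping cliques contribute less than the main term. Janson's inequality
  (\<open>janson_inequality\<close>) then bounds the probability of having no edge of a given label by
  \<open>exp (- \<Omega>(n))\<close>, on average over the labels. The label classes are negatively correlated
  (\<open>colour_classes_negatively_correlated\<close>), so the probability of having no edge at all is at most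
  \<open>exp (- \<Omega>(m * n))\<close>, which beats the number \<open>N ^ n\<close> of \<open>n\<close>-sets when \<open>log N\<close> is a small multiple
  of \<open>m\<close> (\<open>labelling_exists\<close>).

  Expectations over random subsets and random colourings are finite sums. Janson's inequality is
  proved by induction on the family of events, the negative correlation by induction on the ground
  set.
\<close>

section \<open>Random subsets and Janson's inequality\<close>

text \<open>
  The expectation of \<open>f X\<close> for a random subset \<open>X\<close> of \<open>U\<close> that contains each element
  independently with probability \<open>p\<close>.
\<close>

definition subset_expectation :: "real \<Rightarrow> 'b set \<Rightarrow> ('b set \<Rightarrow> real) \<Rightarrow> real" where
  "subset_expectation p U f = (\<Sum>X\<in>Pow U. p ^ card X * (1 - p) ^ card (U - X) * f X)"

lemma subset_expectation_cong:
  assumes "\<And>X. X \<subseteq> U \<Longrightarrow> f X = g X"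
  shows "subset_expectation p U f = subset_expectation p U g"
  unfolding subset_expectation_def using assms by (intro sum.cong) auto

lemma subset_expectation_mono:
  assumes "0 \<le> p" "p \<le> 1" "\<And>X. X \<subseteq> U \<Longrightarrow> f X \<le> g X"
  shows "subset_expectation p U f \<le> subset_expectation p U g"
  unfolding subset_expectation_def using assms by (intro sum_mono mult_left_mono) auto

lemma subset_expectation_nonneg:
  assumes "0 \<le> p" "p \<le> 1" "\<And>X. X \<subseteq> U \<Longrightarrow> 0 \<le> f X"
  shows "0 \<le> subset_expectation p U f"
  unfolding subset_expectation_def using assms by (intro sum_nonneg mult_nonneg_nonneg) auto

lemma subset_expectation_zero [simp]: "subset_expectation p U (\<lambda>X. 0) = 0"
  by (simp add: subset_expectation_def)

lemma subset_expectation_diff: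
  "subset_expectation p U (\<lambda>X. f X - g X) = subset_expectation p U f - subset_expectation p U g"
  by (simp add: subset_expectation_def sum_subtractf right_diff_distrib)

lemma subset_expectation_sum:
  "subset_expectation p U (\<lambda>X. \<Sum>t\<in>I. f t X) = (\<Sum>t\<in>I. subset_expectation p U (f t))"
  unfolding subset_expectation_def sum_distrib_left by (rule sum.swap)

lemma subset_expectation_empty [simp]: "subset_expectation p {} f = f {}"
  by (simp add: subset_expectation_def)

text \<open>
  Conditioning on whether \<open>x\<close> is chosen. This recursion is the form in which the independence of
  the elements enters every induction on the ground set.
\<close>

lemma subset_expectation_insert:
  assumes "finite U" "x \<notin> U"
  shows "subset_expectation p (insert x U) f =
    p * subset_expectation p U (\<lambda>X. f (insert x X)) + (1 - p) * subset_expectation p U f"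
proof -
  let ?w = "\<lambda>X. p ^ card X * (1 - p) ^ card (insert x U - X) * f X"
  have inj: "inj_on (insert x) (Pow U)"
  proof (rule inj_onI)
    fix X Y assume "X \<in> Pow U" "Y \<in> Pow U" "insert x X = insert x Y"
    moreover from this have "x \<notin> X" "x \<notin> Y" using assms(2) by auto
    ultimately show "X = Y" by (simp add: insert_ident)
  qed
  have "subset_expectation p (insert x U) f = sum ?w (Pow U) + sum ?w (insert x ` Pow U)"
    unfolding subset_expectation_def Pow_insert
    by (rule sum.union_disjoint) (use assms in auto)
  moreover have "sum ?w (Pow U) = (1 - p) * subset_expectation p U f"
    unfolding subset_expectation_def sum_distrib_left
  proof (intro sum.cong refl)
    fix X assume "X \<in> Pow U"
    then have "insert x U - X = insert x (U - X)" using assms by auto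
    then show "?w X = (1 - p) * (p ^ card X * (1 - p) ^ card (U - X) * f X)"
      using assms by simp
  qed
  moreover have "sum ?w (insert x ` Pow U) = p * subset_expectation p U (\<lambda>X. f (insert x X))"
    unfolding subset_expectation_def sum_distrib_left sum.reindex[OF inj] o_def
  proof (intro sum.cong refl)
    fix X assume X: "X \<in> Pow U"
    then have "insert x U - insert x X = U - X" using assms by auto
    moreover have "finite X" "x \<notin> X" using X assms finite_subset by auto
    ultimately show "?w (insert x X) = p * (p ^ card X * (1 - p) ^ card (U - X) * f (insert x X))"
      by simp
  qed
  ultimately show ?thesis by simp
qed

lemma subset_expectation_one [simp]:
  "finite U \<Longrightarrow> subset_expectation p U (\<lambda>X. 1) = 1"
  by (induction U rule: finite_induct) (auto simp: subset_expectation_insert)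

text \<open>
  Conditioned on \<open>T \<subseteq> X\<close>, the random set is distributed as \<open>X \<union> T\<close>. For an antitone \<open>f\<close> this
  already bounds the left-hand side by \<open>p ^ card T\<close> times the expectation of \<open>f\<close>, the special case
  of Harris's correlation inequality on which Janson's inequality rests.
\<close>

lemma subset_expectation_superset:
  assumes "finite U" "T \<subseteq> U"
  shows "subset_expectation p U (\<lambda>X. if T \<subseteq> X then f X else 0) =
    p ^ card T * subset_expectation p U (\<lambda>X. f (X \<union> T))"
  using assms
proof (induction U arbitrary: T f rule: finite_induct)
  case empty
  then show ?case by simp
next
  case (insert x U)
  show ?case
  proof (cases "x \<in> T")
    case True
    define T' where "T' = T - {x}"
    have T: "T = insert x T'" "x \<notin> T'" "T' \<subseteq> U"
      using True insert.prems by (auto simp: T'_def)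
    have fin: "finite T'" using T(3) insert.hyps(1) finite_subset by blast
    have "subset_expectation p U (\<lambda>X. if T \<subseteq> X then f X else 0) = subset_expectation p U (\<lambda>X. 0)"
      using T(1) insert.hyps(2) by (intro subset_expectation_cong) auto
    moreover have "subset_expectation p U (\<lambda>X. if T \<subseteq> insert x X then f (insert x X) else 0)
        = subset_expectation p U (\<lambda>X. if T' \<subseteq> X then f (insert x X) else 0)"
      using T insert.hyps(2) by (intro subset_expectation_cong) auto
    ultimately have "subset_expectation p (insert x U) (\<lambda>X. if T \<subseteq> X then f X else 0)
        = p * (p ^ card T' * subset_expectation p U (\<lambda>X. f (insert x (X \<union> T'))))"
      using insert T by (simp add: subset_expectation_insert)
    also have "\<dots> = p ^ card T * subset_expectation p (insert x U) (\<lambda>X. f (X \<union> T))"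
      using insert T fin by (simp add: subset_expectation_insert algebra_simps)
    finally show ?thesis .
  next
    case False
    then have sub: "T \<subseteq> U" "\<And>X. T \<subseteq> insert x X \<longleftrightarrow> T \<subseteq> X"
      using insert.prems by auto
    show ?thesis
      using insert.hyps insert.IH[OF sub(1)] insert.IH[OF sub(1), of "\<lambda>X. f (insert x X)"]
      by (simp add: subset_expectation_insert sub(2) algebra_simps)
  qed
qed

text \<open>
  The indicator of the event that no member of \<open>F\<close> is contained in \<open>X\<close>, as a real number so
  that it can be averaged and multiplied.
\<close>

definition avoids :: "'b set set \<Rightarrow> 'b set \<Rightarrow> real" where
  "avoids F X = (if \<exists>T\<in>F. T \<subseteq> X then 0 else 1)"

lemma avoids_antimono: "X \<subseteq> Y \<Longrightarrow> avoids F Y \<le> avoids F X"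
  by (auto simp: avoids_def)

lemma avoids_family_antimono: "F \<subseteq> G \<Longrightarrow> avoids G X \<le> avoids F X"
  by (auto simp: avoids_def)

lemma avoids_nonneg: "0 \<le> avoids F X"
  by (simp add: avoids_def)

lemma avoids_Un_disjoint:
  assumes "\<And>S. S \<in> F \<Longrightarrow> S \<inter> T = {}"
  shows "avoids F (X \<union> T) = avoids F X"
proof -
  have "S \<subseteq> X \<union> T \<longleftrightarrow> S \<subseteq> X" if "S \<in> F" for S
    using assms[OF that] by auto
  then show ?thesis by (auto simp: avoids_def)
qed

text \<open>
  One step of the Boppana--Spencer proof of Janson's inequality. Split \<open>F\<close> into the sets \<open>D\<close>
  that meet \<open>T\<close> and the sets \<open>G\<close> disjoint from \<open>T\<close>. Among the sets \<open>X\<close> avoiding \<open>F\<close>, those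
  that contain \<open>T\<close> are lost. Avoiding \<open>G\<close> is independent of containing \<open>T\<close>, so the event that
  \<open>X\<close> contains \<open>T\<close> and avoids \<open>G\<close> has probability \<open>p ^ card T\<close> times that of avoiding \<open>G\<close>;
  the part of it in which some \<open>S\<close> of \<open>D\<close> is also contained is at most \<open>p ^ card (S \<union> T)\<close> times
  that of avoiding \<open>G\<close>, because avoiding is antitone. Finally avoiding \<open>G\<close> is at least as likely
  as avoiding \<open>F\<close>, and \<open>1 - b \<le> exp (- b)\<close> turns the lost fraction \<open>b\<close> into the exponent.
\<close>

lemma avoids_insert_expectation_le:
  assumes U: "finite U" and F: "finite F" "\<And>S. S \<in> F \<Longrightarrow> S \<subseteq> U" and T: "T \<subseteq> U"
    and p: "0 \<le> p" "p \<le> 1"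
  shows "subset_expectation p U (avoids (insert T F)) \<le> subset_expectation p U (avoids F) *
    exp (- (p ^ card T - (\<Sum>S\<in>{S \<in> F. S \<inter> T \<noteq> {}}. p ^ card (S \<union> T))))"
proof -
  let ?E = "subset_expectation p U"
  define D where "D = {S \<in> F. S \<inter> T \<noteq> {}}"
  define G where "G = {S \<in> F. S \<inter> T = {}}"
  define b where "b = p ^ card T - (\<Sum>S\<in>D. p ^ card (S \<union> T))"
  have FG: "?E (avoids F) \<le> ?E (avoids G)"
    using p by (intro subset_expectation_mono avoids_family_antimono) (auto simp: G_def)
  have F0: "0 \<le> ?E (avoids F)"
    using p by (intro subset_expectation_nonneg avoids_nonneg)
  have fD: "finite D" using F by (simp add: D_def)
  have main: "?E (avoids (insert T F)) \<le> ?E (avoids F) - b * ?E (avoids G)"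
  proof -
    \<comment> \<open>A union bound over \<open>D\<close>, stated pointwise.\<close>
    have pt: "avoids (insert T F) X \<le> avoids F X -
        ((if T \<subseteq> X then avoids G X else 0) - (\<Sum>S\<in>D. if S \<union> T \<subseteq> X then avoids G X else 0))" for X
    proof (cases "T \<subseteq> X \<and> avoids G X = 1")
      case False
      then have "(if T \<subseteq> X then avoids G X else 0) = 0" by (auto simp: avoids_def split: if_splits)
      moreover have "0 \<le> (\<Sum>S\<in>D. if S \<union> T \<subseteq> X then avoids G X else 0)"
        by (intro sum_nonneg) (simp add: avoids_nonneg)
      moreover have "avoids (insert T F) X \<le> avoids F X"
        by (intro avoids_family_antimono) auto
      ultimately show ?thesis by linarith
    next
      case True
      then have "avoids (insert T F) X = 0" by (auto simp: avoids_def)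
      moreover have "1 \<le> avoids F X + (\<Sum>S\<in>D. if S \<union> T \<subseteq> X then avoids G X else 0)"
      proof (cases "\<exists>S\<in>D. S \<subseteq> X")
        case hit: True
        then obtain S where S: "S \<in> D" "S \<subseteq> X" by blast
        have "(if S \<union> T \<subseteq> X then avoids G X else 0) \<le>
            (\<Sum>S\<in>D. if S \<union> T \<subseteq> X then avoids G X else 0)"
          using S fD by (intro member_le_sum) (auto simp: avoids_nonneg)
        then show ?thesis using S True avoids_nonneg[of F X] by auto
      next
        case False
        have "F = D \<union> G" by (auto simp: D_def G_def)
        then have "avoids F X = 1" using False True by (auto simp: avoids_def split: if_splits)
        moreover have "0 \<le> (\<Sum>S\<in>D. if S \<union> T \<subseteq> X then avoids G X else 0)"
          by (intro sum_nonneg) (simp add: avoids_nonneg)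
        ultimately show ?thesis by simp
      qed
      ultimately show ?thesis using True by simp
    qed
    have GT: "avoids G (X \<union> T) = avoids G X" for X
      by (rule avoids_Un_disjoint) (simp add: G_def)
    have hitT: "?E (\<lambda>X. if T \<subseteq> X then avoids G X else 0) = p ^ card T * ?E (avoids G)"
      using subset_expectation_superset[OF U T, of p "avoids G"]
      by (simp add: GT)
    have hitS: "?E (\<lambda>X. if S \<union> T \<subseteq> X then avoids G X else 0) \<le> p ^ card (S \<union> T) * ?E (avoids G)"
      if "S \<in> D" for S
    proof -
      have "S \<union> T \<subseteq> U" using that F T by (auto simp: D_def)
      then have "?E (\<lambda>X. if S \<union> T \<subseteq> X then avoids G X else 0) =
          p ^ card (S \<union> T) * ?E (\<lambda>X. avoids G (X \<union> (S \<union> T)))"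
        by (rule subset_expectation_superset[OF U])
      also have "\<dots> \<le> p ^ card (S \<union> T) * ?E (avoids G)"
        using p by (intro mult_left_mono subset_expectation_mono avoids_antimono) auto
      finally show ?thesis .
    qed
    have "?E (avoids (insert T F)) \<le> ?E (\<lambda>X. avoids F X -
        ((if T \<subseteq> X then avoids G X else 0) - (\<Sum>S\<in>D. if S \<union> T \<subseteq> X then avoids G X else 0)))"
      using p pt by (intro subset_expectation_mono)
    also have "\<dots> = ?E (avoids F) - (p ^ card T * ?E (avoids G) -
        (\<Sum>S\<in>D. ?E (\<lambda>X. if S \<union> T \<subseteq> X then avoids G X else 0)))"
      by (simp only: subset_expectation_diff subset_expectation_sum hitT)
    also have "\<dots> \<le> ?E (avoids F) - (p ^ card T * ?E (avoids G) -
        (\<Sum>S\<in>D. p ^ card (S \<union> T) * ?E (avoids G)))"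
      using sum_mono[OF hitS] by simp
    also have "\<dots> = ?E (avoids F) - b * ?E (avoids G)"
      by (simp add: b_def left_diff_distrib sum_distrib_right)
    finally show ?thesis .
  qed
  have "?E (avoids (insert T F)) \<le> ?E (avoids F) * exp (- b)"
  \<comment> \<open>Replacing \<open>G\<close> by \<open>F\<close> needs \<open>b \<ge> 0\<close>; for negative \<open>b\<close> the claim is weaker than monotonicity in the family.\<close>
  proof (cases "0 \<le> b")
    case True
    then have "?E (avoids (insert T F)) \<le> ?E (avoids F) - b * ?E (avoids F)"
      using main mult_left_mono[OF FG True] by linarith
    also have "\<dots> = ?E (avoids F) * (1 + - b)" by (simp add: algebra_simps)
    also have "\<dots> \<le> ?E (avoids F) * exp (- b)"
      using F0 by (intro mult_left_mono exp_ge_add_one_self)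
    finally show ?thesis .
  next
    case False
    have "?E (avoids (insert T F)) \<le> ?E (avoids F) * 1"
      using p by (simp add: subset_expectation_mono avoids_family_antimono subset_insertI)
    also have "\<dots> \<le> ?E (avoids F) * exp (- b)"
      using F0 False by (intro mult_left_mono) auto
    finally show ?thesis .
  qed
  then show ?thesis by (simp add: b_def D_def)
qed

text \<open>
  The sets of \<open>F\<close> are added one at a time. Each step only sees the correlations with the sets added
  before, so summing over all ordered pairs of distinct intersecting sets counts each pair twice,
  which costs nothing here because the correlations will be smaller than the main term.
\<close>

lemma janson_inequality:
  assumes U: "finite U" and F: "finite F" "\<And>S. S \<in> F \<Longrightarrow> S \<subseteq> U" and p: "0 \<le> p" "p \<le> 1"
  shows "subset_expectation p U (avoids F) \<le>
    exp (- (\<Sum>T\<in>F. p ^ card T - (\<Sum>S\<in>{S \<in> F - {T}. S \<inter> T \<noteq> {}}. p ^ card (S \<union> T))))"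
  using F
proof (induction F rule: finite_induct)
  case empty
  then show ?case using U by (simp add: avoids_def)
next
  case (insert T F)
  let ?b = "\<lambda>F T. p ^ card T - (\<Sum>S\<in>{S \<in> F - {T}. S \<inter> T \<noteq> {}}. p ^ card (S \<union> T))"
  have "subset_expectation p U (avoids (insert T F)) \<le> subset_expectation p U (avoids F) *
    exp (- (p ^ card T - (\<Sum>S\<in>{S \<in> F. S \<inter> T \<noteq> {}}. p ^ card (S \<union> T))))"
    using insert U p by (intro avoids_insert_expectation_le) auto
  also have "\<dots> \<le> exp (- (\<Sum>A\<in>F. ?b F A)) *
    exp (- (p ^ card T - (\<Sum>S\<in>{S \<in> F. S \<inter> T \<noteq> {}}. p ^ card (S \<union> T))))"
    using insert by (intro mult_right_mono) auto
  also have "\<dots> = exp (- ((\<Sum>A\<in>F. ?b F A) + ?b (insert T F) T))"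
  proof -
    have "{S \<in> insert T F - {T}. S \<inter> T \<noteq> {}} = {S \<in> F. S \<inter> T \<noteq> {}}"
      using insert.hyps by auto
    then show ?thesis by (simp only: exp_add[symmetric] minus_add_distrib)
  qed
  also have "\<dots> \<le> exp (- ((\<Sum>A\<in>F. ?b (insert T F) A) + ?b (insert T F) T))"
  proof -
    have "(\<Sum>A\<in>F. ?b (insert T F) A) \<le> (\<Sum>A\<in>F. ?b F A)"
      using p insert.hyps(1) by (intro sum_mono diff_left_mono sum_mono2) auto
    then show ?thesis by simp
  qed
  also have "\<dots> = exp (- (\<Sum>A\<in>insert T F. ?b (insert T F) A))"
    by (simp only: sum.insert[OF insert.hyps] add.commute)
  finally show ?case .
qed

section \<open>Negative correlation of the colour classes of a random colouring\<close>

text \<open>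
  A weighted form of the inequality \<open>1 - \<Sum>x\<^sub>i \<le> \<Prod>(1 - x\<^sub>i)\<close> of Weierstrass, written without
  division so that vanishing \<open>a i\<close> are covered.
\<close>

lemma prod_sub_ge:
  fixes a d :: "'i \<Rightarrow> real"
  assumes "finite I" "\<And>i. i \<in> I \<Longrightarrow> 0 \<le> d i" "\<And>i. i \<in> I \<Longrightarrow> d i \<le> a i" "0 \<le> t" "t \<le> 1"
  shows "prod a I - t * (\<Sum>j\<in>I. d j * prod a (I - {j})) \<le> (\<Prod>i\<in>I. a i - t * d i)"
  using assms(1-3)
proof (induction I rule: finite_induct)
  case empty
  then show ?case by simp
next
  case (insert k I)
  define S where "S = (\<Sum>j\<in>I. d j * prod a (I - {j}))"
  have S0: "0 \<le> S"
    unfolding S_def using insert.prems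
    by (intro sum_nonneg mult_nonneg_nonneg prod_nonneg) (auto intro: order_trans)
  have dk: "0 \<le> d k" "t * d k \<le> a k"
    using insert.prems[of k] assms(4,5) mult_right_mono[of t 1 "d k"] by auto
  have "(\<Sum>j\<in>I. d j * prod a (insert k I - {j})) = (\<Sum>j\<in>I. a k * (d j * prod a (I - {j})))"
  proof (intro sum.cong refl)
    fix j assume "j \<in> I"
    then have "insert k I - {j} = insert k (I - {j})" using insert.hyps by auto
    then show "d j * prod a (insert k I - {j}) = a k * (d j * prod a (I - {j}))"
      using insert.hyps by simp
  qed
  then have sum: "(\<Sum>j\<in>insert k I. d j * prod a (insert k I - {j})) = d k * prod a I + a k * S"
    using insert.hyps by (simp add: S_def sum_distrib_left)
  have "prod a (insert k I) - t * (d k * prod a I + a k * S)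
      \<le> (a k - t * d k) * (prod a I - t * S)"
    using insert.hyps S0 dk assms(4) by (simp add: algebra_simps)
  also have "\<dots> \<le> (a k - t * d k) * (\<Prod>i\<in>I. a i - t * d i)"
    using insert dk by (intro mult_left_mono) (auto simp: S_def)
  finally show ?case using insert.hyps sum by simp
qed

text \<open>
  The case of a single new element: it lies in exactly one of the \<open>m\<close> classes on the left, and in
  each class independently with probability \<open>1 / m\<close> on the right. Here \<open>b i\<close> and \<open>a i\<close> are the
  expectations for class \<open>i\<close> with and without the element.
\<close>

lemma sum_prod_replace_one_le:
  fixes a b :: "nat \<Rightarrow> real"
  assumes "0 < m" "\<And>i. i < m \<Longrightarrow> 0 \<le> b i" "\<And>i. i < m \<Longrightarrow> b i \<le> a i"
  shows "(\<Sum>j<m. \<Prod>i<m. if i = j then b i else a i)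
    \<le> real m * (\<Prod>i<m. 1 / real m * b i + (1 - 1 / real m) * a i)"
proof -
  define A where "A = (\<Prod>i<m. a i)"
  let ?P = "\<lambda>j. prod a ({..<m} - {j})"
  have "(\<Prod>i<m. if i = j then b i else a i) = A - (a j - b j) * ?P j" if "j < m" for j
  proof -
    have "(\<Prod>i<m. if i = j then b i else a i) = b j * ?P j"
      using that by (subst prod.remove[of _ j]) (auto intro!: prod.cong)
    moreover have "A = a j * ?P j"
      unfolding A_def using that by (subst prod.remove[of _ j]) auto
    ultimately show ?thesis by (simp add: algebra_simps)
  qed
  then have "(\<Sum>j<m. \<Prod>i<m. if i = j then b i else a i) = real m * A - (\<Sum>j<m. (a j - b j) * ?P j)"
    by (simp add: sum_subtractf)
  also have "\<dots> = real m * (A - 1 / real m * (\<Sum>j<m. (a j - b j) * ?P j))"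
    using assms(1) by (simp add: field_simps)
  also have "\<dots> \<le> real m * (\<Prod>i<m. a i - 1 / real m * (a i - b i))"
    unfolding A_def using assms by (intro mult_left_mono prod_sub_ge) auto
  also have "(\<Prod>i<m. a i - 1 / real m * (a i - b i))
      = (\<Prod>i<m. 1 / real m * b i + (1 - 1 / real m) * a i)"
    by (intro prod.cong) (auto simp: algebra_simps)
  finally show ?thesis .
qed

lemma sum_PiE_insert:
  fixes g :: "('b \<Rightarrow> nat) \<Rightarrow> real"
  assumes "x \<notin> U"
  shows "(\<Sum>\<phi>\<in>insert x U \<rightarrow>\<^sub>E B. g \<phi>) = (\<Sum>j\<in>B. \<Sum>\<phi>\<in>U \<rightarrow>\<^sub>E B. g (\<phi>(x := j)))"
proof -
  have "(\<Sum>\<phi>\<in>insert x U \<rightarrow>\<^sub>E B. g \<phi>) = (\<Sum>(j, \<phi>)\<in>B \<times> (U \<rightarrow>\<^sub>E B). g (\<phi>(x := j)))"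
    unfolding PiE_insert_eq
    using sum.reindex[OF inj_combinator[OF assms, of "\<lambda>_. B"], of g]
    by (simp add: o_def case_prod_unfold)
  then show ?thesis by (simp add: sum.cartesian_product)
qed

text \<open>
  The classes of a uniformly random colouring compete for the elements, so it is harder for all of
  them to be small at once than it would be for independent random sets of density \<open>1 / m\<close>. This
  lets Janson's inequality be applied to each colour separately.
\<close>

lemma colour_classes_negatively_correlated:
  fixes f :: "nat \<Rightarrow> 'b set \<Rightarrow> real"
  assumes "finite U" "0 < m" "\<And>i X. i < m \<Longrightarrow> 0 \<le> f i X"
    and "\<And>i X Y. i < m \<Longrightarrow> X \<subseteq> Y \<Longrightarrow> f i Y \<le> f i X"
  shows "(\<Sum>\<phi>\<in>U \<rightarrow>\<^sub>E {..<m}. \<Prod>i<m. f i {u \<in> U. \<phi> u = i})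
    \<le> real m ^ card U * (\<Prod>i<m. subset_expectation (1 / real m) U (f i))"
  using assms(1,3,4)
proof (induction U arbitrary: f rule: finite_induct)
  case empty
  then show ?case by simp
next
  case (insert x U)
  let ?E = "subset_expectation (1 / real m) U"
  have p: "0 \<le> 1 / real m" "1 / real m \<le> 1" using assms(2) by auto
  \<comment> \<open>The function that class \<open>i\<close> faces on \<open>U\<close> once \<open>x\<close> has received colour \<open>j\<close>.\<close>
  define g where "g j i X = (if i = j then f i (insert x X) else f i X)" for i j :: nat and X
  have split: "(\<Prod>i<m. f i {u \<in> insert x U. (\<phi>(x := j)) u = i})
      = (\<Prod>i<m. g j i {u \<in> U. \<phi> u = i})" for j \<phi>
  proof (intro prod.cong refl)
    fix i
    have "{u \<in> insert x U. (\<phi>(x := j)) u = i}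
        = (if i = j then insert x {u \<in> U. \<phi> u = i} else {u \<in> U. \<phi> u = i})"
      using insert.hyps by auto
    then show "f i {u \<in> insert x U. (\<phi>(x := j)) u = i} = g j i {u \<in> U. \<phi> u = i}"
      by (simp add: g_def)
  qed
  have IH: "(\<Sum>\<phi>\<in>U \<rightarrow>\<^sub>E {..<m}. \<Prod>i<m. g j i {u \<in> U. \<phi> u = i})
      \<le> real m ^ card U * (\<Prod>i<m. ?E (g j i))" for j
  proof (rule insert.IH)
    show "0 \<le> g j i X" if "i < m" for i X using insert.prems(1) that by (simp add: g_def)
    show "g j i Y \<le> g j i X" if "i < m" "X \<subseteq> Y" for i X Y
      using insert.prems(2)[OF that] insert.prems(2)[OF that(1), of "insert x X" "insert x Y"] that(2)
      by (auto simp: g_def)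
  qed
  have Eg: "?E (g j i) = (if i = j then ?E (\<lambda>X. f i (insert x X)) else ?E (f i))" for i j
    unfolding g_def by (cases "i = j") simp_all
  have "(\<Sum>\<phi>\<in>insert x U \<rightarrow>\<^sub>E {..<m}. \<Prod>i<m. f i {u \<in> insert x U. \<phi> u = i})
      = (\<Sum>j<m. \<Sum>\<phi>\<in>U \<rightarrow>\<^sub>E {..<m}. \<Prod>i<m. g j i {u \<in> U. \<phi> u = i})"
    by (simp only: sum_PiE_insert[OF insert.hyps(2)] split)
  also have "\<dots> \<le> (\<Sum>j<m. real m ^ card U * (\<Prod>i<m. ?E (g j i)))"
    using IH by (intro sum_mono)
  also have "\<dots> = real m ^ card U *
      (\<Sum>j<m. \<Prod>i<m. if i = j then ?E (\<lambda>X. f i (insert x X)) else ?E (f i))"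
    by (simp only: sum_distrib_left Eg)
  also have "\<dots> \<le> real m ^ card U * (real m * (\<Prod>i<m. 1 / real m * ?E (\<lambda>X. f i (insert x X))
      + (1 - 1 / real m) * ?E (f i)))"
    using insert.prems p assms(2)
    by (intro mult_left_mono sum_prod_replace_one_le subset_expectation_nonneg
          subset_expectation_mono) (auto simp: subset_insertI)
  also have "\<dots> = real m ^ card (insert x U) *
      (\<Prod>i<m. subset_expectation (1 / real m) (insert x U) (f i))"
    using insert.hyps by (simp add: subset_expectation_insert)
  finally show ?case .
qed

section \<open>Colourings under which every set is often rainbow\<close>

text \<open>
  A fixed bijection of \<open>e\<close> onto the colours extends to \<open>r ^ (N - r)\<close> colourings, so \<open>e\<close> is rainbow
  for at least a fraction \<open>1 / r ^ r\<close> of all colourings; each of them loses half of its weight.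
\<close>

lemma sum_rainbow_weight_le:
  assumes e: "e \<in> [{..<N}]\<^bsup>r\<^esup>" and r: "0 < r"
  shows "(\<Sum>\<chi>\<in>{..<N} \<rightarrow>\<^sub>E {..<r}. if bij_betw \<chi> e {..<r} then 1 / 2 else 1)
    \<le> real r ^ N * (1 - 1 / (2 * real r ^ r))"
proof -
  let ?All = "{..<N} \<rightarrow>\<^sub>E {..<r}"
  define B where "B = {\<chi> \<in> ?All. bij_betw \<chi> e {..<r}}"
  have e': "e \<subseteq> {..<N}" "finite e" "card e = r" using e by (auto simp: nsets_def)
  have rN: "r \<le> N" using card_mono[OF _ e'(1)] e'(3) by simp
  obtain g where g: "bij_betw g e {..<r}"
    using finite_same_card_bij[of e "{..<r}"] e' by auto
  define P where "P = PiE {..<N} (\<lambda>v. if v \<in> e then {g v} else {..<r})"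
  have fin: "finite ?All" by (intro finite_PiE) auto
  have "P \<subseteq> B"
  proof
    fix \<chi> assume \<chi>: "\<chi> \<in> P"
    have "\<chi> v = g v" if "v \<in> e" for v
      using PiE_mem[OF \<chi>[unfolded P_def], of v] that e' by auto
    then have "bij_betw \<chi> e {..<r}" using g by (simp cong: bij_betw_cong)
    moreover have "\<chi> \<in> ?All"
    proof (rule PiE_I)
      fix v assume v: "v \<in> {..<N}"
      show "\<chi> v \<in> {..<r}"
        using PiE_mem[OF \<chi>[unfolded P_def] v] bij_betwE[OF g] by (cases "v \<in> e") auto
    qed (use \<chi> in \<open>auto simp: P_def PiE_iff extensional_def\<close>)
    ultimately show "\<chi> \<in> B" by (simp add: B_def)
  qed
  moreover have "card P = r ^ (N - r)"
  proof -
    have "card P = (\<Prod>v<N. if v \<in> e then 1 else r)"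
      unfolding P_def by (subst card_PiE) (auto intro!: prod.cong)
    also have "\<dots> = (\<Prod>v\<in>{..<N} - e. r)"
      by (rule prod.mono_neutral_cong_right) auto
    finally show ?thesis using e' by (simp add: card_Diff_subset)
  qed
  ultimately have "r ^ (N - r) \<le> card B"
    using card_mono[of B P] fin by (auto simp: B_def)
  then have cB: "real r ^ (N - r) \<le> card B" by (metis of_nat_le_iff of_nat_power)
  have "(\<Sum>\<chi>\<in>?All. if bij_betw \<chi> e {..<r} then 1 / 2 else 1)
      = (\<Sum>\<chi>\<in>?All. 1 - (if bij_betw \<chi> e {..<r} then 1 / 2 else 0 :: real))"
    by (intro sum.cong) auto
  also have "\<dots> = card ?All - real (card B) / 2"
    using fin by (simp add: sum_subtractf sum.If_cases B_def Int_def)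
  also have "card ?All = r ^ N" by (simp add: card_PiE)
  also have "real (r ^ N) - real (card B) / 2 \<le> real r ^ N - real r ^ (N - r) / 2"
    using cB by simp
  also have "\<dots> = real r ^ N * (1 - 1 / (2 * real r ^ r))"
    using r rN by (simp add: right_diff_distrib power_diff)
  finally show ?thesis .
qed

lemma exists_le_average:
  fixes g :: "'b \<Rightarrow> real"
  assumes "finite A" "A \<noteq> {}" "sum g A \<le> real (card A) * c"
  shows "\<exists>x\<in>A. g x \<le> c"
proof (rule ccontr)
  assume "\<not> ?thesis"
  then have "(\<Sum>x\<in>A. c) < sum g A" using assms by (intro sum_strict_mono) auto
  then show False using assms(3) by simp
qed

lemma card_nsets: "finite A \<Longrightarrow> card ([A]\<^bsup>k\<^esup>) = card A choose k"
proof -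
  assume A: "finite A"
  then have "[A]\<^bsup>k\<^esup> = {B. B \<subseteq> A \<and> card B = k}"
    by (auto simp: nsets_def intro: finite_subset)
  then show ?thesis using n_subsets[OF A, of k] by simp
qed

lemma binomial_le_power: "real (n choose k) \<le> real n ^ k"
proof -
  have "n choose k \<le> n ^ k" by (cases "k \<le> n") (auto simp: binomial_le_pow binomial_eq_0)
  then show ?thesis by (metis of_nat_le_iff of_nat_power)
qed

text \<open>
  An exponential moment argument. For \<open>m\<close> independent random colourings, the weight \<open>W e \<chi>\<close>,
  which is \<open>1 / 2\<close> to the number of colourings making \<open>e\<close> rainbow, has an expectation that
  factorises over the colourings. Some choice makes the sum of the weights over all \<open>e\<close> at most
  average, and then every single weight is that small.
\<close>

lemma rainbow_colourings_exist:
  assumes r: "0 < r"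
  shows "\<exists>\<chi> :: nat \<Rightarrow> nat \<Rightarrow> nat. (\<forall>i<m. \<chi> i ` {..<N} \<subseteq> {..<r}) \<and>
    (\<forall>e\<in>[{..<N}]\<^bsup>r\<^esup>. (1 / 2) ^ card {i. i < m \<and> bij_betw (\<chi> i) e {..<r}}
       \<le> real N ^ r * (1 - 1 / (2 * real r ^ r)) ^ m)"
proof -
  let ?All = "{..<N} \<rightarrow>\<^sub>E {..<r}" and ?V = "[{..<N}]\<^bsup>r\<^esup>"
  let ?q = "1 - 1 / (2 * real r ^ r)"
  define w where "w e \<chi> = (if bij_betw \<chi> e {..<r} then 1 / 2 else 1 :: real)" for e :: "nat set" and \<chi> :: "nat \<Rightarrow> nat"
  define W where "W e \<chi> = (\<Prod>i<m. w e (\<chi> i))" for e and \<chi> :: "nat \<Rightarrow> nat \<Rightarrow> nat"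
  have fin: "finite ?All" "finite ?V"
    by (auto intro: finite_PiE finite_imp_finite_nsets)
  have cardAll: "card ({..<m} \<rightarrow>\<^sub>E ?All) = (r ^ N) ^ m"
    by (simp add: card_PiE)
  have finAll: "finite ({..<m} \<rightarrow>\<^sub>E ?All)" using fin by (intro finite_PiE) auto
  have ne: "{..<m} \<rightarrow>\<^sub>E ?All \<noteq> {}" using r by (simp add: PiE_eq_empty_iff) blast
  have q0: "0 \<le> ?q"
  proof -
    have "1 \<le> real r ^ r" using r by simp
    then have "0 < 2 * real r ^ r" "1 \<le> 2 * real r ^ r" by linarith+
    then show ?thesis by (simp add: divide_le_eq_1)
  qed
  have W0: "0 \<le> W e \<chi>" for e \<chi> by (simp add: W_def w_def prod_nonneg)
  have We: "(\<Sum>\<chi>\<in>{..<m} \<rightarrow>\<^sub>E ?All. W e \<chi>) \<le> (real r ^ N * ?q) ^ m" if "e \<in> ?V" for e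
  proof -
    have "(\<Sum>\<chi>\<in>{..<m} \<rightarrow>\<^sub>E ?All. W e \<chi>) = (\<Prod>i<m. \<Sum>\<chi>\<in>?All. w e \<chi>)"
      unfolding W_def using fin
      by (intro prod_sum_PiE[of "{..<m}" "\<lambda>_. ?All" "\<lambda>_. w e", symmetric]) simp_all
    also have "\<dots> \<le> (\<Prod>i<m. real r ^ N * ?q)"
      using sum_rainbow_weight_le[OF that r]
      by (intro prod_mono conjI sum_nonneg) (simp_all add: w_def)
    finally show ?thesis by simp
  qed
  have "(\<Sum>\<chi>\<in>{..<m} \<rightarrow>\<^sub>E ?All. \<Sum>e\<in>?V. W e \<chi>) = (\<Sum>e\<in>?V. \<Sum>\<chi>\<in>{..<m} \<rightarrow>\<^sub>E ?All. W e \<chi>)"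
    by (rule sum.swap)
  also have "\<dots> \<le> (\<Sum>e\<in>?V. (real r ^ N * ?q) ^ m)" using We by (rule sum_mono)
  also have "\<dots> = real (card ({..<m} \<rightarrow>\<^sub>E ?All)) * (real (N choose r) * ?q ^ m)"
    by (simp only: cardAll) (simp add: card_nsets power_mult_distrib)
  also have "\<dots> \<le> real (card ({..<m} \<rightarrow>\<^sub>E ?All)) * (real N ^ r * ?q ^ m)"
  proof -
    show ?thesis using q0 binomial_le_power by (intro mult_left_mono mult_right_mono) auto
  qed
  finally obtain \<chi> where \<chi>: "\<chi> \<in> {..<m} \<rightarrow>\<^sub>E ?All" "(\<Sum>e\<in>?V. W e \<chi>) \<le> real N ^ r * ?q ^ m"
    using exists_le_average[OF finAll ne] by blast
  have "(1 / 2) ^ card {i. i < m \<and> bij_betw (\<chi> i) e {..<r}} \<le> real N ^ r * ?q ^ m"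
    if "e \<in> ?V" for e
  proof -
    have "(1 / 2) ^ card {i. i < m \<and> bij_betw (\<chi> i) e {..<r}} = W e \<chi>"
      by (simp add: W_def w_def prod.If_cases Int_def)
    also have "\<dots> \<le> (\<Sum>e\<in>?V. W e \<chi>)"
      using W0 by (intro member_le_sum that fin)
    finally show ?thesis using \<chi>(2) by linarith
  qed
  moreover have "\<forall>i<m. \<chi> i ` {..<N} \<subseteq> {..<r}" using \<chi>(1) by (fastforce simp: PiE_iff)
  ultimately show ?thesis by (intro exI[of _ \<chi>] conjI ballI)
qed

text \<open>
  While \<open>N\<close> is at most exponential in \<open>m\<close>, every \<open>r\<close>-set can be made rainbow for a positive
  fraction of the \<open>m\<close> colourings.
\<close>

lemma rainbow_colourings_exist_linear:
  assumes r: "0 < r"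
  shows "\<exists>\<epsilon>>0. \<forall>N m. real N ^ r \<le> 2 powr (\<epsilon> * real m) \<longrightarrow>
    (\<exists>\<chi> :: nat \<Rightarrow> nat \<Rightarrow> nat. (\<forall>i<m. \<chi> i ` {..<N} \<subseteq> {..<r}) \<and>
      (\<forall>e\<in>[{..<N}]\<^bsup>r\<^esup>. \<epsilon> * real m \<le> card {i. i < m \<and> bij_betw (\<chi> i) e {..<r}}))"
proof -
  define q where "q = 1 - 1 / (2 * real r ^ r)"
  have "1 \<le> real r ^ r" using r by simp
  then have "0 < 2 * real r ^ r" "1 < 2 * real r ^ r" by linarith+
  then have q: "0 < q" "q < 1" by (auto simp: q_def divide_less_eq_1)
  \<comment> \<open>Half of the decay rate of \<open>q ^ m\<close> pays for the factor \<open>N ^ r\<close>, the other half is the conclusion.\<close>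
  define \<epsilon> where "\<epsilon> = - log 2 q / 2"
  have \<epsilon>: "0 < \<epsilon>" using q by (simp add: \<epsilon>_def)
  have q\<epsilon>: "q = 2 powr (- 2 * \<epsilon>)"
  proof -
    have "- 2 * \<epsilon> = log 2 q" by (simp add: \<epsilon>_def)
    moreover have "2 powr log 2 q = q" using q(1) by simp
    ultimately show ?thesis by simp
  qed
  have "\<exists>\<chi> :: nat \<Rightarrow> nat \<Rightarrow> nat. (\<forall>i<m. \<chi> i ` {..<N} \<subseteq> {..<r}) \<and>
      (\<forall>e\<in>[{..<N}]\<^bsup>r\<^esup>. \<epsilon> * real m \<le> card {i. i < m \<and> bij_betw (\<chi> i) e {..<r}})"
    if N: "real N ^ r \<le> 2 powr (\<epsilon> * real m)" for N m :: nat
  proof -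
    obtain \<chi> :: "nat \<Rightarrow> nat \<Rightarrow> nat" where \<chi>: "\<forall>i<m. \<chi> i ` {..<N} \<subseteq> {..<r}"
      and le: "\<forall>e\<in>[{..<N}]\<^bsup>r\<^esup>.
        (1 / 2) ^ card {i. i < m \<and> bij_betw (\<chi> i) e {..<r}} \<le> real N ^ r * q ^ m"
      using rainbow_colourings_exist[OF r, of m N, folded q_def] by (elim exE conjE)
    have "\<epsilon> * real m \<le> card {i. i < m \<and> bij_betw (\<chi> i) e {..<r}}" if "e \<in> [{..<N}]\<^bsup>r\<^esup>" for e
    proof -
      let ?c = "card {i. i < m \<and> bij_betw (\<chi> i) e {..<r}}"
      have "2 powr (- real ?c) = (1 / 2) ^ ?c"
        by (simp add: powr_minus_divide powr_realpow power_divide)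
      also have "\<dots> \<le> 2 powr (\<epsilon> * real m) * q ^ m"
        using q(1) by (intro order_trans[OF bspec[OF le that] mult_right_mono[OF N]]) simp
      also have "q ^ m = q powr real m" using q(1) by (simp add: powr_realpow)
      also have "\<dots> = 2 powr (- 2 * \<epsilon> * real m)" by (simp only: q\<epsilon> powr_powr)
      also have "2 powr (\<epsilon> * real m) * 2 powr (- 2 * \<epsilon> * real m) = 2 powr (- (\<epsilon> * real m))"
        by (simp add: powr_add[symmetric])
      finally show ?thesis by simp
    qed
    with \<chi> show ?thesis by (intro exI[of _ \<chi>] conjI ballI)
  qed
  with \<epsilon> show ?thesis by (intro exI[of _ \<epsilon>] conjI allI impI)
qed

section \<open>Avoiding cliques in a sparse random uniform hypergraph\<close>

lemma binomial_ratio_step: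
  assumes "2 \<le> k" "k \<le> r"
  shows "(r choose k) * r \<le> (Suc r choose k) * (r - 1)"
proof -
  have absorb: "(Suc r - k) * (Suc r choose k) = Suc r * (r choose k)"
    using binomial_absorb_comp[of "Suc r" k] by simp
  have "r * (Suc r - k) \<le> Suc r * (r - 1)"
  proof -
    have "r * (Suc r - k) \<le> r * (r - 1)" using assms by (intro mult_le_mono) auto
    also have "\<dots> \<le> Suc r * (r - 1)" by (intro mult_le_mono1) simp
    finally show ?thesis .
  qed
  then have "(r choose k) * (r * (Suc r - k)) \<le> (r choose k) * (Suc r * (r - 1))"
    by (rule mult_le_mono2)
  also have "\<dots> = (Suc r - k) * (Suc r choose k) * (r - 1)"
    by (simp only: absorb) (simp only: ac_simps)
  finally have "(Suc r - k) * ((r choose k) * r) \<le> (Suc r - k) * ((Suc r choose k) * (r - 1))"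
    by (simp only: ac_simps)
  then show ?thesis using assms by simp
qed

text \<open>
  The ratio \<open>(s choose k) / (s - 1)\<close> does not decrease with \<open>s\<close>, for \<open>k \<ge> 2\<close>. This says that the
  complete \<open>k\<close>-graph on \<open>r\<close> vertices has no subclique that is relatively denser than itself, and
  it is what makes overlapping cliques rare at the density used below.
\<close>

lemma binomial_ratio_mono:
  assumes k: "2 \<le> k" "k \<le> s" and "s \<le> r"
  shows "(s choose k) * (r - 1) \<le> (r choose k) * (s - 1)"
  using assms(3)
proof (induction r rule: dec_induct)
  case base
  then show ?case by simp
next
  case (step r)
  have "(r - 1) * ((s choose k) * r) \<le> (r choose k) * r * (s - 1)"
    using mult_le_mono2[OF step.IH, of r] by (simp only: ac_simps)
  also have "\<dots> \<le> (Suc r choose k) * (r - 1) * (s - 1)"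
    using k step.hyps by (intro mult_le_mono1 binomial_ratio_step) auto
  finally have "(r - 1) * ((s choose k) * r) \<le> (r - 1) * ((Suc r choose k) * (s - 1))"
    by (simp only: ac_simps)
  then show ?case using k step.hyps by simp
qed

lemma binomial_less_binomial:
  assumes "0 < k" "k \<le> s" "s < r"
  shows "(s choose k) < (r choose k)"
proof -
  obtain k' where k': "k = Suc k'" using assms(1) by (cases k) auto
  have "(s choose k) < (Suc s choose k)" using assms(2) by (simp add: k')
  also have "\<dots> \<le> (r choose k)" using assms(3) by (intro binomial_right_mono) auto
  finally show ?thesis .
qed

lemma card_sets_meeting_in_le:
  assumes "finite A" "W \<subseteq> A"
  shows "real (card {e' \<in> [A]\<^bsup>r\<^esup>. e \<inter> e' = W}) \<le> real (card A) ^ (r - card W)"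
proof -
  let ?M = "{e' \<in> [A]\<^bsup>r\<^esup>. e \<inter> e' = W}"
  have "inj_on (\<lambda>e'. e' - W) ?M"
  proof (rule inj_on_inverseI)
    show "(e' - W) \<union> W = e'" if "e' \<in> ?M" for e' using that by blast
  qed
  moreover have "(\<lambda>e'. e' - W) ` ?M \<subseteq> nsets A (r - card W)"
    using assms finite_subset[OF assms(2,1)] by (auto simp: nsets_def card_Diff_subset)
  ultimately have "card ?M \<le> card (nsets A (r - card W))"
    using finite_imp_finite_nsets[OF assms(1)] by (rule card_inj_on_le)
  then have "real (card ?M) \<le> real (card A choose (r - card W))"
    using assms(1) by (simp add: card_nsets)
  also have "\<dots> \<le> real (card A) ^ (r - card W)" by (rule binomial_le_power)
  finally show ?thesis .
qed

lemma nsets_Int: "[A]\<^bsup>k\<^esup> \<inter> [B]\<^bsup>k\<^esup> = [A \<inter> B]\<^bsup>k\<^esup>"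
  by (auto simp: nsets_def)

text \<open>
  A set with at least \<open>k\<close> elements is the union of its \<open>k\<close>-subsets.
\<close>

lemma inj_on_nsets:
  assumes "0 < k" "k \<le> r"
  shows "inj_on (\<lambda>e. [e]\<^bsup>k\<^esup>) ([A]\<^bsup>r\<^esup>)"
proof (rule inj_onI)
  have cover: "\<Union> ([e]\<^bsup>k\<^esup>) = e" if "e \<in> [A]\<^bsup>r\<^esup>" for e
  proof (intro equalityI subsetI)
    fix x assume x: "x \<in> e"
    have e: "finite e" "card e = r" using that by (auto simp: nsets_def)
    obtain S where "{x} \<subseteq> S" "S \<subseteq> e" "card S = k"
      using exists_subset_between[of "{x}" k e] x e assms by auto
    then show "x \<in> \<Union> ([e]\<^bsup>k\<^esup>)" using e finite_subset by (auto simp: nsets_def)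
  qed (auto simp: nsets_def)
  fix e e' assume "e \<in> [A]\<^bsup>r\<^esup>" "e' \<in> [A]\<^bsup>r\<^esup>" "[e]\<^bsup>k\<^esup> = [e']\<^bsup>k\<^esup>"
  then show "e = e'" by (metis cover)
qed

text \<open>
  The correlation term of Janson's inequality for the events that all \<open>k\<close>-subsets of \<open>e\<close> are
  chosen, at density \<open>1 / m\<close>. The sets \<open>e'\<close> are grouped by their intersection \<open>W\<close> with \<open>e\<close>: at
  most \<open>card A ^ (r - card W)\<close> of them share a given \<open>W\<close>, and there are at most \<open>2 ^ r\<close>
  intersections. The constant \<open>2 ^ (r + 1)\<close> in the sparsity hypothesis makes the total at most half
  of the probability of a single event.
\<close>

lemma clique_correlation_le:
  fixes m :: nat
  assumes A: "finite A" and R: "R \<subseteq> [A]\<^bsup>r\<^esup>" and e: "e \<in> R" and m: "0 < m"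
    and sparse: "\<And>s. k \<le> s \<Longrightarrow> s < r \<Longrightarrow>
      2 ^ (r + 1) * real (card A) ^ (r - s) \<le> real m ^ ((r choose k) - (s choose k))"
  shows "(\<Sum>e'\<in>{e' \<in> R - {e}. k \<le> card (e \<inter> e')}. (1 / real m) ^ card ([e']\<^bsup>k\<^esup> \<union> [e]\<^bsup>k\<^esup>))
    \<le> (1 / real m) ^ (r choose k) / 2"
proof -
  let ?p = "1 / real m" and ?C = "r choose k"
  let ?M = "{e' \<in> R - {e}. k \<le> card (e \<inter> e')}"
  let ?W = "{W \<in> Pow e. k \<le> card W \<and> card W < r}"
  have ecard: "e \<subseteq> A" "finite e" "card e = r" using e R by (auto simp: nsets_def)
  have finM: "finite ?M"
    using finite_subset[OF R finite_imp_finite_nsets[OF A]] by simp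
  have finW: "finite ?W" using ecard by simp
  have overlap: "(\<lambda>e'. e \<inter> e') ` ?M \<subseteq> ?W"
  proof (rule image_subsetI)
    fix e' assume "e' \<in> ?M"
    then have e': "e' \<in> R" "e' \<noteq> e" "k \<le> card (e \<inter> e')" by auto
    have e'card: "finite e'" "card e' = r" using e' R by (auto simp: nsets_def)
    have "e \<inter> e' \<subset> e"
      using e'(2) card_subset_eq[OF e'card(1), of e] ecard e'card by auto
    then have "card (e \<inter> e') < r" using psubset_card_mono[OF ecard(2)] ecard by auto
    then show "e \<inter> e' \<in> ?W" using e' by auto
  qed
  have cardU: "card ([e']\<^bsup>k\<^esup> \<union> [e]\<^bsup>k\<^esup>) = ?C + (?C - (card (e \<inter> e') choose k))" if "e' \<in> ?M" for e'
  proof -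
    have e': "finite e'" "card e' = r" using that R by (auto simp: nsets_def)
    have "card ([e']\<^bsup>k\<^esup> \<union> [e]\<^bsup>k\<^esup>) + card ([e']\<^bsup>k\<^esup> \<inter> [e]\<^bsup>k\<^esup>) = ?C + ?C"
      using card_Un_Int[of "[e']\<^bsup>k\<^esup>" "[e]\<^bsup>k\<^esup>"] e' ecard
      by (simp add: card_nsets finite_imp_finite_nsets)
    moreover have "card ([e']\<^bsup>k\<^esup> \<inter> [e]\<^bsup>k\<^esup>) = card (e \<inter> e') choose k"
      using ecard by (simp add: nsets_Int Int_commute card_nsets)
    moreover have "card (e \<inter> e') choose k \<le> ?C"
      using card_mono[OF ecard(2), of "e \<inter> e'"] ecard by (intro binomial_right_mono) auto
    ultimately show ?thesis by linarith
  qed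
  have group: "(\<Sum>e'\<in>{e' \<in> ?M. e \<inter> e' = W}. ?p ^ card ([e']\<^bsup>k\<^esup> \<union> [e]\<^bsup>k\<^esup>)) \<le> ?p ^ ?C / 2 ^ (r + 1)"
    if W: "W \<in> ?W" for W
  proof -
    let ?d = "?C - (card W choose k)"
    have "card {e' \<in> ?M. e \<inter> e' = W} \<le> card {e' \<in> [A]\<^bsup>r\<^esup>. e \<inter> e' = W}"
      using R by (intro card_mono) (auto simp: finite_imp_finite_nsets[OF A])
    also have "real \<dots> \<le> real (card A) ^ (r - card W)"
      using W ecard by (intro card_sets_meeting_in_le A) auto
    finally have cnt: "real (card {e' \<in> ?M. e \<inter> e' = W}) \<le> real (card A) ^ (r - card W)" by simp
    have "(\<Sum>e'\<in>{e' \<in> ?M. e \<inter> e' = W}. ?p ^ card ([e']\<^bsup>k\<^esup> \<union> [e]\<^bsup>k\<^esup>))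
        = (\<Sum>e'\<in>{e' \<in> ?M. e \<inter> e' = W}. ?p ^ (?C + ?d))"
    proof (intro sum.cong refl)
      fix e' assume e': "e' \<in> {e' \<in> ?M. e \<inter> e' = W}"
      then have "e' \<in> ?M" "e \<inter> e' = W" by auto
      then have "card ([e']\<^bsup>k\<^esup> \<union> [e]\<^bsup>k\<^esup>) = ?C + ?d" using cardU[OF \<open>e' \<in> ?M\<close>] by simp
      then show "?p ^ card ([e']\<^bsup>k\<^esup> \<union> [e]\<^bsup>k\<^esup>) = ?p ^ (?C + ?d)" by (rule arg_cong)
    qed
    also have "\<dots> \<le> real (card A) ^ (r - card W) * ?p ^ (?C + ?d)"
      unfolding sum_constant using cnt by (rule mult_right_mono) simp
    also have "\<dots> = ?p ^ ?C * (real (card A) ^ (r - card W) / real m ^ ?d)"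
      by (simp add: power_add power_divide)
    also have "\<dots> \<le> ?p ^ ?C * (1 / 2 ^ (r + 1))"
    proof (rule mult_left_mono)
      have "2 ^ (r + 1) * real (card A) ^ (r - card W) \<le> real m ^ ?d" using W by (intro sparse) auto
      then show "real (card A) ^ (r - card W) / real m ^ ?d \<le> 1 / 2 ^ (r + 1)"
        using m by (simp add: divide_simps mult.commute)
    qed simp
    finally show ?thesis by simp
  qed
  have "(\<Sum>e'\<in>?M. ?p ^ card ([e']\<^bsup>k\<^esup> \<union> [e]\<^bsup>k\<^esup>))
      = (\<Sum>W\<in>?W. \<Sum>e'\<in>{e' \<in> ?M. e \<inter> e' = W}. ?p ^ card ([e']\<^bsup>k\<^esup> \<union> [e]\<^bsup>k\<^esup>))"
    by (rule sum.group[OF finM finW overlap, symmetric])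
  also have "\<dots> \<le> (\<Sum>W\<in>?W. ?p ^ ?C / 2 ^ (r + 1))" using group by (rule sum_mono)
  also have "\<dots> = real (card ?W) * (?p ^ ?C / 2 ^ (r + 1))" by simp
  also have "\<dots> \<le> 2 ^ r * (?p ^ ?C / 2 ^ (r + 1))"
  proof -
    have "card ?W \<le> card (Pow e)" using ecard by (intro card_mono) auto
    then have "real (card ?W) \<le> 2 ^ r" using ecard by (simp add: card_Pow flip: of_nat_le_iff)
    then show ?thesis by (intro mult_right_mono) auto
  qed
  also have "\<dots> = ?p ^ ?C / 2" by simp
  finally show ?thesis .
qed

text \<open>
  By the bound on the correlations, each \<open>e\<close> in \<open>R\<close> still contributes half of its probability to
  the exponent in Janson's inequality.
\<close>

lemma clique_free_expectation_le:
  fixes m :: nat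
  assumes V: "finite V" "A \<subseteq> V" and R: "R \<subseteq> [A]\<^bsup>r\<^esup>" and m: "0 < m" and k: "0 < k" "k \<le> r"
    and sparse: "\<And>s. k \<le> s \<Longrightarrow> s < r \<Longrightarrow>
      2 ^ (r + 1) * real (card A) ^ (r - s) \<le> real m ^ ((r choose k) - (s choose k))"
  shows "subset_expectation (1 / real m) ([V]\<^bsup>k\<^esup>) (avoids ((\<lambda>e. [e]\<^bsup>k\<^esup>) ` R))
    \<le> exp (- (real (card R) / (2 * real m ^ (r choose k))))"
proof -
  let ?p = "1 / real m" and ?C = "r choose k" and ?T = "\<lambda>e. [e]\<^bsup>k\<^esup>"
  have A: "finite A" using V finite_subset by blast
  have finR: "finite R" using finite_subset[OF R finite_imp_finite_nsets[OF A]] .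
  have inj: "inj_on ?T R" using inj_on_subset[OF inj_on_nsets[OF k] R] .
  have p: "0 \<le> ?p" "?p \<le> 1" using m by auto
  have sub: "T \<subseteq> [V]\<^bsup>k\<^esup>" if T: "T \<in> ?T ` R" for T
  proof -
    obtain e where e: "e \<in> R" "T = [e]\<^bsup>k\<^esup>" using T by blast
    then have "e \<in> [A]\<^bsup>r\<^esup>" using R by blast
    then have "e \<subseteq> V" using V(2) by (auto simp: nsets_def)
    then show ?thesis by (simp add: e(2) nsets_mono)
  qed
  let ?D = "\<lambda>T. {S \<in> ?T ` R - {T}. S \<inter> T \<noteq> {}}"
  have half: "?p ^ ?C / 2 \<le> ?p ^ card (?T e) - (\<Sum>S\<in>?D (?T e). ?p ^ card (S \<union> ?T e))"
    if e: "e \<in> R" for e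
  proof -
    let ?M = "{e' \<in> R - {e}. k \<le> card (e \<inter> e')}"
    have ecard: "finite e" "card e = r" using e R by (auto simp: nsets_def)
    have "?D (?T e) \<subseteq> ?T ` ?M"
    proof
      fix S assume "S \<in> ?D (?T e)"
      then obtain e' where e': "S = [e']\<^bsup>k\<^esup>" "e' \<in> R" "[e']\<^bsup>k\<^esup> \<noteq> [e]\<^bsup>k\<^esup>" "[e']\<^bsup>k\<^esup> \<inter> [e]\<^bsup>k\<^esup> \<noteq> {}"
        by blast
      then have "[e \<inter> e']\<^bsup>k\<^esup> \<noteq> {}" by (simp add: nsets_Int Int_commute)
      then have "k \<le> card (e \<inter> e')" using ecard by (simp add: nsets_eq_empty_iff)
      then show "S \<in> ?T ` ?M" using e' by blast
    qed
    then have "(\<Sum>S\<in>?D (?T e). ?p ^ card (S \<union> ?T e)) \<le> (\<Sum>S\<in>?T ` ?M. ?p ^ card (S \<union> ?T e))"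
      using finR by (intro sum_mono2) auto
    also have "\<dots> = (\<Sum>e'\<in>?M. ?p ^ card (?T e' \<union> ?T e))"
    proof -
      have "inj_on ?T ?M" by (rule inj_on_subset[OF inj]) auto
      then show ?thesis by (simp only: sum.reindex o_def)
    qed
    also have "\<dots> \<le> ?p ^ ?C / 2" by (rule clique_correlation_le[OF A R e m sparse])
    finally show ?thesis using ecard by (simp add: card_nsets)
  qed
  have "real (card R) / (2 * real m ^ ?C) = (\<Sum>e\<in>R. ?p ^ ?C / 2)"
    by (simp add: power_divide)
  also have "\<dots> \<le> (\<Sum>e\<in>R. ?p ^ card (?T e) - (\<Sum>S\<in>?D (?T e). ?p ^ card (S \<union> ?T e)))"
    using half by (rule sum_mono)
  also have "\<dots> = (\<Sum>T\<in>?T ` R. ?p ^ card T - (\<Sum>S\<in>?D T. ?p ^ card (S \<union> T)))"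
    by (simp add: sum.reindex[OF inj] o_def)
  finally have exponent: "real (card R) / (2 * real m ^ ?C)
      \<le> (\<Sum>T\<in>?T ` R. ?p ^ card T - (\<Sum>S\<in>?D T. ?p ^ card (S \<union> T)))" .
  have "subset_expectation ?p ([V]\<^bsup>k\<^esup>) (avoids (?T ` R))
      \<le> exp (- (\<Sum>T\<in>?T ` R. ?p ^ card T - (\<Sum>S\<in>?D T. ?p ^ card (S \<union> T))))"
    by (intro janson_inequality finite_imp_finite_nsets finite_imageI V(1) finR sub p)
  also have "\<dots> \<le> exp (- (real (card R) / (2 * real m ^ ?C)))"
    using exponent by simp
  finally show ?thesis .
qed

section \<open>Labelling the small sets so that every large set contains an edge\<close>

text \<open>
  Label the \<open>k\<close>-sets uniformly at random. A fixed \<open>A\<close> fails only if for no label \<open>i\<close> the class of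
  \<open>i\<close> contains all \<open>k\<close>-subsets of an \<open>r\<close>-set \<open>e \<subseteq> A\<close> with \<open>Q i e\<close>. By negative correlation the
  probability of this is at most the product over the labels of the bounds from Janson's inequality;
  their exponents add up to at least the one in the last hypothesis, by counting the pairs \<open>(i, e)\<close> with \<open>Q i e\<close>. A
  union bound over the at most \<open>N ^ n\<close> sets \<open>A\<close> finishes the argument.
\<close>

lemma labelling_exists:
  fixes m n N r k :: nat and Q :: "nat \<Rightarrow> nat set \<Rightarrow> bool" and d :: real
  assumes m: "0 < m" and k: "0 < k" "k \<le> r"
    and rich: "\<And>e. e \<in> [{..<N}]\<^bsup>r\<^esup> \<Longrightarrow> d \<le> card {i. i < m \<and> Q i e}"
    and sparse: "\<And>s. k \<le> s \<Longrightarrow> s < r \<Longrightarrow>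
      2 ^ (r + 1) * real n ^ (r - s) \<le> real m ^ ((r choose k) - (s choose k))"
    and few: "real N ^ n < exp (d * real (n choose r) / (2 * real m ^ (r choose k)))"
  shows "\<exists>\<phi>. \<forall>A\<in>[{..<N}]\<^bsup>n\<^esup>. \<exists>e\<in>[A]\<^bsup>r\<^esup>. \<exists>i<m. Q i e \<and> (\<forall>S\<in>[e]\<^bsup>k\<^esup>. \<phi> S = i)"
proof -
  let ?V = "{..<N}" and ?C = "r choose k"
  let ?U = "[?V]\<^bsup>k\<^esup>"
  define R where "R A i = {e \<in> [A]\<^bsup>r\<^esup>. Q i e}" for A i
  define F where "F A i = (\<lambda>e. [e]\<^bsup>k\<^esup>) ` R A i" for A i
  \<comment> \<open>\<open>W A \<phi>\<close> is the indicator of the event that \<open>A\<close> fails for the labelling \<open>\<phi>\<close>.\<close>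
  define W where "W A \<phi> = (\<Prod>i<m. avoids (F A i) {S \<in> ?U. \<phi> S = i})" for A and \<phi> :: "nat set \<Rightarrow> nat"
  define D where "D = d * real (n choose r) / (2 * real m ^ ?C)"
  have finU: "finite ?U" by (simp add: finite_imp_finite_nsets)
  have cardAll: "real (card (?U \<rightarrow>\<^sub>E {..<m})) = real m ^ card ?U"
    using finU by (simp add: card_PiE)
  have WA: "(\<Sum>\<phi>\<in>?U \<rightarrow>\<^sub>E {..<m}. W A \<phi>) \<le> real m ^ card ?U * exp (- D)"
    if A: "A \<in> [?V]\<^bsup>n\<^esup>" for A
  proof -
    have A': "finite A" "A \<subseteq> ?V" "card A = n" using A by (auto simp: nsets_def)
    have finA: "finite ([A]\<^bsup>r\<^esup>)" using A' by (simp add: finite_imp_finite_nsets)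
    have "D \<le> (\<Sum>i<m. real (card (R A i)) / (2 * real m ^ ?C))"
    proof -
      have "d * real (n choose r) = (\<Sum>e\<in>[A]\<^bsup>r\<^esup>. d)" using A' by (simp add: card_nsets)
      also have "\<dots> \<le> (\<Sum>e\<in>[A]\<^bsup>r\<^esup>. real (card {i. i < m \<and> Q i e}))"
        using nsets_mono[OF A'(2)] by (intro sum_mono rich) auto
      also have "\<dots> = (\<Sum>e\<in>[A]\<^bsup>r\<^esup>. \<Sum>i<m. if Q i e then 1 else 0)"
        by (simp add: sum.If_cases Int_def)
      also have "\<dots> = (\<Sum>i<m. \<Sum>e\<in>[A]\<^bsup>r\<^esup>. if Q i e then 1 else 0)" by (rule sum.swap)
      also have "\<dots> = (\<Sum>i<m. real (card (R A i)))"
        using finA by (simp add: sum.If_cases Int_def R_def)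
      finally show ?thesis
        unfolding D_def sum_divide_distrib[symmetric] by (rule divide_right_mono) simp
    qed
    have "(\<Sum>\<phi>\<in>?U \<rightarrow>\<^sub>E {..<m}. W A \<phi>)
        \<le> real m ^ card ?U * (\<Prod>i<m. subset_expectation (1 / real m) ?U (avoids (F A i)))"
      unfolding W_def using m finU
      by (intro colour_classes_negatively_correlated avoids_nonneg avoids_antimono)
    also have "\<dots> \<le> real m ^ card ?U * (\<Prod>i<m. exp (- (real (card (R A i)) / (2 * real m ^ ?C))))"
    proof (intro mult_left_mono prod_mono conjI)
      fix i
      show "0 \<le> subset_expectation (1 / real m) ?U (avoids (F A i))"
        using m by (intro subset_expectation_nonneg avoids_nonneg) auto
      show "subset_expectation (1 / real m) ?U (avoids (F A i))
          \<le> exp (- (real (card (R A i)) / (2 * real m ^ ?C)))"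
        unfolding F_def
        by (rule clique_free_expectation_le[OF _ A'(2) _ m k])
           (use sparse A' in \<open>auto simp: R_def\<close>)
    qed simp
    also have "(\<Prod>i<m. exp (- (real (card (R A i)) / (2 * real m ^ ?C))))
        = exp (- (\<Sum>i<m. real (card (R A i)) / (2 * real m ^ ?C)))"
      by (simp add: exp_sum[symmetric] sum_negf)
    also have "real m ^ card ?U * \<dots> \<le> real m ^ card ?U * exp (- D)"
      using \<open>D \<le> _\<close> by (intro mult_left_mono) auto
    finally show ?thesis .
  qed
  have "(\<Sum>\<phi>\<in>?U \<rightarrow>\<^sub>E {..<m}. \<Sum>A\<in>[?V]\<^bsup>n\<^esup>. W A \<phi>) = (\<Sum>A\<in>[?V]\<^bsup>n\<^esup>. \<Sum>\<phi>\<in>?U \<rightarrow>\<^sub>E {..<m}. W A \<phi>)"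
    by (rule sum.swap)
  also have "\<dots> \<le> (\<Sum>A\<in>[?V]\<^bsup>n\<^esup>. real m ^ card ?U * exp (- D))" using WA by (rule sum_mono)
  also have "\<dots> = real (card (?U \<rightarrow>\<^sub>E {..<m})) * (real (N choose n) * exp (- D))"
    unfolding cardAll by (simp add: card_nsets)
  also have "\<dots> \<le> real (card (?U \<rightarrow>\<^sub>E {..<m})) * (real N ^ n * exp (- D))"
    by (intro mult_left_mono mult_right_mono binomial_le_power) auto
  finally have avg: "(\<Sum>\<phi>\<in>?U \<rightarrow>\<^sub>E {..<m}. \<Sum>A\<in>[?V]\<^bsup>n\<^esup>. W A \<phi>)
      \<le> real (card (?U \<rightarrow>\<^sub>E {..<m})) * (real N ^ n * exp (- D))" .
  have "finite (?U \<rightarrow>\<^sub>E {..<m})" using finU by (intro finite_PiE) auto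
  moreover have "?U \<rightarrow>\<^sub>E {..<m} \<noteq> {}" using m by (auto simp: PiE_eq_empty_iff)
  ultimately obtain \<phi> where \<phi>: "(\<Sum>A\<in>[?V]\<^bsup>n\<^esup>. W A \<phi>) \<le> real N ^ n * exp (- D)"
    using exists_le_average[OF _ _ avg] by blast
  have "real N ^ n * exp (- D) < exp D * exp (- D)"
    using few by (intro mult_strict_right_mono) (auto simp: D_def)
  also have "\<dots> = 1" by (simp add: exp_minus)
  finally have lt1: "(\<Sum>A\<in>[?V]\<^bsup>n\<^esup>. W A \<phi>) < 1" using \<phi> by linarith
  have "\<exists>e\<in>[A]\<^bsup>r\<^esup>. \<exists>i<m. Q i e \<and> (\<forall>S\<in>[e]\<^bsup>k\<^esup>. \<phi> S = i)" if A: "A \<in> [?V]\<^bsup>n\<^esup>" for A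
  proof -
    have "W A \<phi> \<le> (\<Sum>A\<in>[?V]\<^bsup>n\<^esup>. W A \<phi>)"
      by (intro member_le_sum A) (auto simp: W_def avoids_nonneg prod_nonneg finite_imp_finite_nsets)
    then have "W A \<phi> \<noteq> 1" using lt1 by linarith
    moreover have "W A \<phi> = 1" if "\<forall>i\<in>{..<m}. avoids (F A i) {S \<in> ?U. \<phi> S = i} = 1"
      unfolding W_def using that by (rule prod.neutral)
    ultimately obtain i where i: "i < m" "avoids (F A i) {S \<in> ?U. \<phi> S = i} \<noteq> 1" by blast
    then obtain e where "e \<in> R A i" "[e]\<^bsup>k\<^esup> \<subseteq> {S \<in> ?U. \<phi> S = i}"
      by (auto simp: avoids_def F_def split: if_splits)
    then show ?thesis using i(1) by (auto simp: R_def)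
  qed
  then show ?thesis by blast
qed

section \<open>The choice of the number of labels\<close>

text \<open>
  With \<open>m\<close> of order \<open>n powr ((r - 1) / (r choose k))\<close>, the expected number of copies of the clique
  with a given label is of order \<open>n\<close>. Given one such clique, the expected number of others that share
  \<open>s\<close> prescribed vertices with it is at most of order \<open>n ^ (r - s) / m ^ ((r choose k) - (s choose k))\<close>.
  Since subcliques are not relatively denser, this is bounded, and a constant factor \<open>L\<close> in \<open>m\<close>
  makes it smaller at least by the factor \<open>L\<close>.
\<close>

lemma sparse_power_bound:
  fixes n m k s r :: nat
  assumes k: "2 \<le> k" "k \<le> s" "s < r" and n: "0 < n" and L: "1 \<le> L"
    and m: "L * real n powr ((real r - 1) / real (r choose k)) \<le> real m"
  shows "L * real n ^ (r - s) \<le> real m ^ ((r choose k) - (s choose k))"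
proof -
  define C where "C = r choose k"
  define d where "d = C - (s choose k)"
  define x where "x = real n powr ((real r - 1) / real C)"
  have less: "(s choose k) < C" unfolding C_def using k by (intro binomial_less_binomial) auto
  then have d: "0 < d" "0 < C" "real d = real C - real (s choose k)" by (auto simp: d_def)
  have "(s choose k) * (r - 1) \<le> C * (s - 1)"
    unfolding C_def using k by (intro binomial_ratio_mono) auto
  then have "real ((s choose k) * (r - 1)) \<le> real (C * (s - 1))" by (rule of_nat_mono)
  moreover have "real (r - 1) = real r - 1" "real (s - 1) = real s - 1"
    using k by (simp_all add: of_nat_diff)
  ultimately have "real (s choose k) * (real r - 1) \<le> real C * (real s - 1)"
    by (simp only: of_nat_mult)
  then have "real C * (real r - real s) \<le> (real r - 1) * real d"
    unfolding d(3) by (simp add: algebra_simps)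
  then have expo: "real (r - s) \<le> (real r - 1) / real C * real d"
    using d(2) k by (simp add: pos_le_divide_eq of_nat_diff mult.commute)
  have x0: "0 \<le> x" by (simp add: x_def)
  have "real n ^ (r - s) = real n powr real (r - s)" using n by (simp add: powr_realpow)
  also have "\<dots> \<le> real n powr ((real r - 1) / real C * real d)"
    using n expo by (intro powr_mono) auto
  also have "\<dots> = x powr real d" by (simp only: x_def powr_powr)
  also have "\<dots> = x ^ d" using n by (intro powr_realpow) (simp add: x_def)
  finally have "L * real n ^ (r - s) \<le> L * x ^ d" using L by (intro mult_left_mono) auto
  also have "\<dots> \<le> L ^ d * x ^ d"
    using L x0 self_le_power[OF L d(1)] by (intro mult_right_mono) auto
  also have "\<dots> = (L * x) ^ d" by (simp add: power_mult_distrib)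
  also have "\<dots> \<le> real m ^ d"
    using m L x0 by (intro power_mono) (auto simp: x_def C_def)
  finally show ?thesis by (simp add: d_def C_def)
qed

text \<open>
  The exponent in the union bound has order \<open>m * n\<close>: it is \<open>m\<close> times the expected number
  \<open>n ^ r / m ^ (r choose k)\<close> of cliques with a given label, and \<open>m ^ (r choose k)\<close> has order
  \<open>n ^ (r - 1)\<close>.
\<close>

lemma expected_count_bound:
  fixes n m k r :: nat and L \<epsilon> x :: real
  assumes r: "0 < r" "r \<le> n" and L: "0 < L" and \<epsilon>: "0 \<le> \<epsilon>" and m: "0 < m"
    and x: "0 \<le> x" "x ^ (r choose k) = real n ^ (r - 1)"
    and mx: "x \<le> real m" "real m \<le> L * x"
  shows "\<epsilon> / (2 * real r ^ r * L ^ (r choose k)) * x * real n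
    \<le> \<epsilon> * real m * real (n choose r) / (2 * real m ^ (r choose k))"
proof -
  let ?C = "r choose k"
  have n: "0 < n" using r by simp
  have nr: "real n ^ r / real r ^ r \<le> real (n choose r)"
    using binomial_ge_n_over_k_pow_k[of r n, where 'a = real] r by (simp add: power_divide)
  have mC: "real m ^ ?C \<le> L ^ ?C * real n ^ (r - 1)"
    using power_mono[OF mx(2), of ?C] by (simp add: power_mult_distrib x)
  have "\<epsilon> / (2 * real r ^ r * L ^ ?C) * x * real n
      = \<epsilon> * x * (real n ^ r / real r ^ r) / (2 * (L ^ ?C * real n ^ (r - 1)))"
  proof -
    have cancel: "\<epsilon> / (2 * R * K) * x * a = \<epsilon> * x * (a * P / R) / (2 * (K * P))"
      if "P \<noteq> 0" for R K P a :: real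
      using that by simp
    have "real n ^ r = real n * real n ^ (r - 1)" using r(1) by (cases r) auto
    then show ?thesis using cancel n by simp
  qed
  also have "\<dots> \<le> \<epsilon> * real m * real (n choose r) / (2 * real m ^ ?C)"
    using \<epsilon> x mx nr mC m by (intro frac_le mult_mono) auto
  finally show ?thesis .
qed

text \<open>
  Take \<open>m\<close> to be \<open>L * n powr ((r - 1) / (r choose k))\<close> rounded up. Both requirements on \<open>N\<close>, from
  the rainbow colourings and from the union bound over \<open>n\<close>-sets, then say that \<open>log N\<close> is at most a
  small constant times \<open>m\<close>.
\<close>

lemma labelled_rainbow_system_exists:
  assumes k: "2 \<le> k" "k < r"
  shows "\<exists>c>0. \<forall>n\<ge>r. \<forall>N. real N < 2 powr (c * real n powr ((real r - 1) / real (r choose k))) \<longrightarrow>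
    (\<exists>(m::nat) \<chi> \<phi>. (\<forall>i<m. \<chi> i ` {..<N} \<subseteq> {..<r}) \<and>
      (\<forall>A\<in>[{..<N}]\<^bsup>n\<^esup>. \<exists>e\<in>[A]\<^bsup>r\<^esup>. \<exists>i<m. bij_betw (\<chi> i) e {..<r} \<and> (\<forall>S\<in>[e]\<^bsup>k\<^esup>. \<phi> S = i)))"
proof -
  let ?C = "r choose k"
  have r: "0 < r" and k': "0 < k" "k \<le> r" and C: "0 < ?C" using k by auto
  obtain \<epsilon> where \<epsilon>: "0 < \<epsilon>" and colourings: "\<forall>N m. real N ^ r \<le> 2 powr (\<epsilon> * real m) \<longrightarrow>
    (\<exists>\<chi> :: nat \<Rightarrow> nat \<Rightarrow> nat. (\<forall>i<m. \<chi> i ` {..<N} \<subseteq> {..<r}) \<and>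
      (\<forall>e\<in>[{..<N}]\<^bsup>r\<^esup>. \<epsilon> * real m \<le> card {i. i < m \<and> bij_betw (\<chi> i) e {..<r}}))"
    using rainbow_colourings_exist_linear[OF r] by (elim exE conjE)
  define L :: real where "L = 2 ^ (r + 1)"
  have L: "1 \<le> L" unfolding L_def by (rule one_le_power) simp
  \<comment> \<open>The first constant serves the existence of the colourings, the second the union bound.\<close>
  define c where "c = min (\<epsilon> / real r) (\<epsilon> / (2 * real r ^ r * (2 * L) ^ ?C))"
  have c: "0 < c" using \<epsilon> r L by (simp add: c_def)
  have "\<exists>(m::nat) \<chi> \<phi>. (\<forall>i<m. \<chi> i ` {..<N} \<subseteq> {..<r}) \<and>
      (\<forall>A\<in>[{..<N}]\<^bsup>n\<^esup>. \<exists>e\<in>[A]\<^bsup>r\<^esup>. \<exists>i<m. bij_betw (\<chi> i) e {..<r} \<and> (\<forall>S\<in>[e]\<^bsup>k\<^esup>. \<phi> S = i))"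
    if n: "r \<le> n" and N: "real N < 2 powr (c * real n powr ((real r - 1) / real ?C))" for n N
  proof -
    define x where "x = real n powr ((real r - 1) / real ?C)"
    have n0: "0 < n" using n r by simp
    have x1: "1 \<le> x" unfolding x_def using n0 r by (intro ge_one_powr_ge_zero) auto
    have xC: "x ^ ?C = real n ^ (r - 1)"
    proof -
      have "x ^ ?C = real n powr (real r - 1)"
        using C n0 by (simp add: x_def powr_powr flip: powr_realpow)
      also have "\<dots> = real n powr real (r - 1)" using r by (simp add: of_nat_diff)
      also have "\<dots> = real n ^ (r - 1)" using n0 by (simp add: powr_realpow)
      finally show ?thesis .
    qed
    have Lx: "1 \<le> L * x" using mult_mono[OF L x1] L by simp
    define m where "m = nat \<lceil>L * x\<rceil>"
    have mL: "L * x \<le> real m" unfolding m_def by (rule real_nat_ceiling_ge)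
    have mU: "real m \<le> 2 * L * x"
    proof -
      have "real m = of_int \<lceil>L * x\<rceil>" using Lx by (simp add: m_def)
      also have "\<dots> \<le> L * x + 1" by (rule of_int_ceiling_le_add_one)
      also have "\<dots> \<le> 2 * L * x" using Lx by linarith
      finally show ?thesis .
    qed
    have m0: "0 < m" using mL Lx by (cases m) auto
    have xm: "x \<le> real m" 
    proof -
      have "1 * x \<le> L * x" using L x1 by (intro mult_right_mono) auto
      then show ?thesis using mL by linarith
    qed
    have Nr: "real N ^ r \<le> 2 powr (\<epsilon> * real m)"
    proof -
      have "real N ^ r \<le> (2 powr (c * x)) ^ r" using N by (intro power_mono) (auto simp: x_def)
      also have "\<dots> = 2 powr (c * real r * x)"
        by (simp add: powr_powr ac_simps flip: powr_realpow)
      also have "\<dots> \<le> 2 powr (\<epsilon> * real m)"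
      proof -
        have "c * real r \<le> \<epsilon>" using r by (simp add: c_def min_def field_simps)
        then have "c * real r * x \<le> \<epsilon> * real m" using xm \<epsilon> x1 by (intro mult_mono) auto
        then show ?thesis by (intro powr_mono) auto
      qed
      finally show ?thesis .
    qed
    obtain \<chi> :: "nat \<Rightarrow> nat \<Rightarrow> nat" where \<chi>: "\<forall>i<m. \<chi> i ` {..<N} \<subseteq> {..<r}"
      and rich: "\<forall>e\<in>[{..<N}]\<^bsup>r\<^esup>. \<epsilon> * real m \<le> card {i. i < m \<and> bij_betw (\<chi> i) e {..<r}}"
      using colourings[rule_format, OF Nr] by (elim exE conjE)
    have few: "real N ^ n < exp (\<epsilon> * real m * real (n choose r) / (2 * real m ^ ?C))"
    proof -
      have "real N ^ n < (2 powr (c * x)) ^ n"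
        using N n0 by (intro power_strict_mono) (auto simp: x_def)
      also have "\<dots> = 2 powr (c * x * real n)"
        by (simp add: powr_powr flip: powr_realpow)
      also have "\<dots> \<le> exp (c * x * real n)"
      proof -
        have "ln 2 \<le> (1::real)" using ln_le_minus_one[of "2::real"] by simp
        then have "c * x * real n * ln 2 \<le> c * x * real n"
          using c x1 by (intro mult_left_le) auto
        then show ?thesis by (simp add: powr_def)
      qed
      also have "c * x * real n \<le> \<epsilon> / (2 * real r ^ r * (2 * L) ^ ?C) * x * real n"
        using x1 by (intro mult_right_mono) (auto simp: c_def)
      also have "\<dots> \<le> \<epsilon> * real m * real (n choose r) / (2 * real m ^ ?C)"
        using r n L \<epsilon> m0 x1 xC xm mU by (intro expected_count_bound) auto
      finally show ?thesis by simp
    qed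
    have sparse: "2 ^ (r + 1) * real n ^ (r - s) \<le> real m ^ (?C - (s choose k))"
      if "k \<le> s" "s < r" for s
      using sparse_power_bound[OF k(1) that n0 L, of m] mL by (simp add: x_def L_def)
    have "\<exists>\<phi>. \<forall>A\<in>[{..<N}]\<^bsup>n\<^esup>. \<exists>e\<in>[A]\<^bsup>r\<^esup>. \<exists>i<m.
        bij_betw (\<chi> i) e {..<r} \<and> (\<forall>S\<in>[e]\<^bsup>k\<^esup>. \<phi> S = i)"
      by (rule labelling_exists[where Q = "\<lambda>i e. bij_betw (\<chi> i) e {..<r}",
            OF m0 k' bspec[OF rich] sparse few])
    then obtain \<phi> where "\<forall>A\<in>[{..<N}]\<^bsup>n\<^esup>. \<exists>e\<in>[A]\<^bsup>r\<^esup>. \<exists>i<m.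
        bij_betw (\<chi> i) e {..<r} \<and> (\<forall>S\<in>[e]\<^bsup>k\<^esup>. \<phi> S = i)"
      by (elim exE)
    with \<chi> show ?thesis by (intro exI conjI)
  qed
  with c show ?thesis by (intro exI[of _ c] conjI allI impI)
qed

section \<open>Tight components of the labelled hypergraph\<close>

text \<open>
  Each \<open>\<chi> i\<close> is a candidate partition of the vertices into \<open>r\<close> parts, and the label \<open>\<phi> S\<close> prescribes
  which of these partitions the edges containing the \<open>k\<close>-set \<open>S\<close> have to respect.
\<close>

definition labelled_edges ::
    "nat \<Rightarrow> nat \<Rightarrow> nat \<Rightarrow> nat \<Rightarrow> (nat \<Rightarrow> nat \<Rightarrow> nat) \<Rightarrow> (nat set \<Rightarrow> nat) \<Rightarrow> nat set set" where
  "labelled_edges N r k m \<chi> \<phi> = {e \<in> [{..<N}]\<^bsup>r\<^esup>. \<exists>i<m. bij_betw (\<chi> i) e {..<r} \<and> (\<forall>S\<in>[e]\<^bsup>k\<^esup>. \<phi> S = i)}"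

text \<open>
  Two edges that share \<open>k\<close> vertices share a \<open>k\<close>-set, and the label of an edge can be read off from
  any of its \<open>k\<close>-sets.
\<close>

lemma tightly_connected_same_label:
  assumes tight: "tightly_connected k EG" and unif: "\<And>e. e \<in> EG \<Longrightarrow> finite e"
    and label: "\<And>e S. e \<in> EG \<Longrightarrow> S \<in> [e]\<^bsup>k\<^esup> \<Longrightarrow> \<psi> S = l e"
    and e: "e \<in> EG" and e': "e' \<in> EG"
  shows "l e = l e'"
proof -
  obtain es where es: "set es = EG"
    and overlap: "\<And>i. 1 \<le> i \<Longrightarrow> i < length es \<Longrightarrow> \<exists>j<i. k \<le> card (es ! i \<inter> es ! j)"
    using tight unfolding tightly_connected_def by blast
  have first: "l (es ! i) = l (es ! 0)" if "i < length es" for i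
    using that
  proof (induction i rule: less_induct)
    case (less i)
    show ?case
    proof (cases "i = 0")
      case False
      then obtain j where j: "j < i" "k \<le> card (es ! i \<inter> es ! j)"
        using overlap[of i] less.prems by auto
      have mem: "es ! i \<in> EG" "es ! j \<in> EG" using es less.prems j by auto
      obtain S where S: "S \<subseteq> es ! i \<inter> es ! j" "card S = k"
        using obtain_subset_with_card_n[OF j(2)] by metis
      have "S \<in> [es ! i]\<^bsup>k\<^esup>" "S \<in> [es ! j]\<^bsup>k\<^esup>"
        using S unif[OF mem(1)] finite_subset[of S "es ! i"] by (auto simp: nsets_def)
      then have "l (es ! i) = l (es ! j)" using label mem by metis
      also have "\<dots> = l (es ! 0)" using j(1) less.prems by (intro less.IH) auto
      finally show ?thesis .
    qed simp
  qed
  have "l e = l (es ! 0)" if "e \<in> EG" for e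
    using that es first unfolding in_set_conv_nth[of e es, unfolded es] by blast
  then show ?thesis using e e' by simp
qed

lemma r_partite_of_rainbow:
  assumes "0 < r" "r_graph r VG EG" "g ` VG \<subseteq> {..<r}" "\<And>e. e \<in> EG \<Longrightarrow> bij_betw g e {..<r}"
  shows "r_partite r VG EG"
  unfolding r_partite_def
proof (intro exI[of _ "\<lambda>i. {v \<in> VG. g v = i}"] conjI ballI allI impI)
  show "disjoint_family_on (\<lambda>i. {v \<in> VG. g v = i}) {..<r}"
    by (auto simp: disjoint_family_on_def)
  show "(\<Union>i<r. {v \<in> VG. g v = i}) = VG" using assms(3) by auto
  fix e i assume e: "e \<in> EG" and i: "i < r"
  have bij: "bij_betw g e {..<r}" using assms(4)[OF e] .
  have sub: "e \<subseteq> VG" using assms(2) e by (auto simp: r_graph_def nsets_def)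
  have "i \<in> g ` e" using bij i by (simp add: bij_betw_def)
  then obtain v where v: "v \<in> e" "g v = i" by blast
  have "e \<inter> {v \<in> VG. g v = i} = {v}"
    using v sub bij by (auto simp: bij_betw_def inj_on_def)
  then show "card (e \<inter> {v \<in> VG. g v = i}) = 1" by simp
qed

text \<open>
  A copy of a tightly connected hypergraph uses edges of a single label \<open>i\<close> only, and pulling the
  partition \<open>\<chi> i\<close> back along the embedding gives a partition of its vertices.
\<close>

lemma copy_in_labelled_edges_r_partite:
  assumes r: "0 < r" and G: "r_graph r VG EG" and tight: "tightly_connected k EG"
    and \<chi>: "\<forall>i<m. \<chi> i ` {..<N} \<subseteq> {..<r}"
    and copy: "contains_copy {..<N} (labelled_edges N r k m \<chi> \<phi>) VG EG"
  shows "r_partite r VG EG"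
proof (cases "EG = {}")
  case True
  then show ?thesis using r by (intro r_partite_of_rainbow[OF r G, of "\<lambda>_. 0"]) auto
next
  case False
  then obtain e0 where e0: "e0 \<in> EG" by blast
  obtain f where inj: "inj_on f VG" and fV: "f ` VG \<subseteq> {..<N}"
    and fE: "\<And>e. e \<in> EG \<Longrightarrow> f ` e \<in> labelled_edges N r k m \<chi> \<phi>"
    using copy unfolding contains_copy_def by blast
  have edge: "e \<subseteq> VG" "finite e" if "e \<in> EG" for e
    using G that by (auto simp: r_graph_def nsets_def)
  have "\<forall>e\<in>EG. \<exists>i<m. bij_betw (\<chi> i) (f ` e) {..<r} \<and> (\<forall>S\<in>[f ` e]\<^bsup>k\<^esup>. \<phi> S = i)"
    using fE unfolding labelled_edges_def by blast
  then obtain l where l: "\<And>e. e \<in> EG \<Longrightarrow> l e < m"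
    "\<And>e. e \<in> EG \<Longrightarrow> bij_betw (\<chi> (l e)) (f ` e) {..<r}"
    "\<And>e S. e \<in> EG \<Longrightarrow> S \<in> [f ` e]\<^bsup>k\<^esup> \<Longrightarrow> \<phi> S = l e"
    by metis
  have label: "\<phi> (f ` S) = l e" if "e \<in> EG" "S \<in> [e]\<^bsup>k\<^esup>" for e S
  proof -
    have S: "S \<subseteq> e" "finite S" "card S = k" using that by (auto simp: nsets_def)
    have "card (f ` S) = k"
      using S edge[OF that(1)] by (metis card_image inj inj_on_subset)
    then have "f ` S \<in> [f ` e]\<^bsup>k\<^esup>" using S by (auto simp: nsets_def)
    then show ?thesis using l(3) that by blast
  qed
  have same: "l e = l e0" if "e \<in> EG" for e
    using tightly_connected_same_label[OF tight, of "\<lambda>S. \<phi> (f ` S)" l e e0] edge label that e0 by blast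
  show ?thesis
  proof (rule r_partite_of_rainbow[OF r G, of "\<chi> (l e0) \<circ> f"])
    show "(\<chi> (l e0) \<circ> f) ` VG \<subseteq> {..<r}"
      using \<chi> l(1)[OF e0] fV by (fastforce simp: image_subset_iff)
    fix e assume e: "e \<in> EG"
    have "bij_betw f e (f ` e)"
      using inj_on_subset[OF inj edge(1)[OF e]] by (rule inj_on_imp_bij_betw)
    then show "bij_betw (\<chi> (l e0) \<circ> f) e {..<r}"
      using l(2)[OF e] same[OF e] by (metis bij_betw_trans)
  qed
qed

section \<open>The lower bound\<close>

theorem corollary1p5:
  fixes r k :: nat and VG :: "'a set" and EG :: "'a set set"
  assumes "3 \<le> r" and "2 \<le> k" and "k \<le> r - 1"
    and "r_graph r VG EG"
    and "tightly_connected k EG"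
    and "\<not> r_partite r VG EG"
  shows "\<exists>c::real. c > 0 \<and> (\<exists>n1::nat. \<forall>n\<ge>n1.
           real (ramsey_number r VG EG n)
             \<ge> 2 powr (c * real n powr ((real r - 1) / real (r choose k))))"
proof -
  have r: "0 < r" "k < r" using assms(1-3) by auto
  obtain c where c: "0 < c" and system: "\<forall>n\<ge>r. \<forall>N.
      real N < 2 powr (c * real n powr ((real r - 1) / real (r choose k))) \<longrightarrow>
      (\<exists>(m::nat) \<chi> \<phi>. (\<forall>i<m. \<chi> i ` {..<N} \<subseteq> {..<r}) \<and>
        (\<forall>A\<in>[{..<N}]\<^bsup>n\<^esup>. \<exists>e\<in>[A]\<^bsup>r\<^esup>. \<exists>i<m. bij_betw (\<chi> i) e {..<r} \<and> (\<forall>S\<in>[e]\<^bsup>k\<^esup>. \<phi> S = i)))"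
    using labelled_rainbow_system_exists[OF assms(2) r(2)] by (elim exE conjE)
  have "2 powr (c * real n powr ((real r - 1) / real (r choose k))) \<le> real (ramsey_number r VG EG n)"
    if n: "r \<le> n" for n
  proof (rule ccontr)
    define N where "N = ramsey_number r VG EG n"
    assume "\<not> ?thesis"
    then have "real N < 2 powr (c * real n powr ((real r - 1) / real (r choose k)))"
      by (simp add: N_def)
    from system[rule_format, OF n this] obtain m :: nat and \<chi> \<phi> where \<chi>: "\<forall>i<m. \<chi> i ` {..<N} \<subseteq> {..<r}"
      and dense: "\<forall>A\<in>[{..<N}]\<^bsup>n\<^esup>. \<exists>e\<in>[A]\<^bsup>r\<^esup>. \<exists>i<m.
          bij_betw (\<chi> i) e {..<r} \<and> (\<forall>S\<in>[e]\<^bsup>k\<^esup>. \<phi> S = i)"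
      by (elim exE conjE)
    define E where "E = labelled_edges N r k m \<chi> \<phi>"
    have "ramsey_property r VG EG n N"
      unfolding N_def ramsey_number_def using ramsey_property_ex[OF assms(4)] by (rule LeastI_ex)
    moreover have "r_graph r {..<N} E" by (auto simp: r_graph_def E_def labelled_edges_def)
    moreover have "\<not> contains_copy {..<N} E VG EG"
      using copy_in_labelled_edges_r_partite[OF r(1) assms(4,5) \<chi>] assms(6) unfolding E_def by blast
    ultimately have "\<exists>A. independent_set {..<N} E A \<and> card A = n"
      using card_lessThan[of N] unfolding ramsey_property_def by blast
    then obtain A where A: "independent_set {..<N} E A" "card A = n" by (elim exE conjE)
    then have AN: "A \<subseteq> {..<N}" by (simp add: independent_set_def)
    then have "A \<in> [{..<N}]\<^bsup>n\<^esup>" using A(2) finite_subset by (auto simp: nsets_def)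
    then obtain e i where e: "e \<in> [A]\<^bsup>r\<^esup>" "i < m" "bij_betw (\<chi> i) e {..<r}" "\<forall>S\<in>[e]\<^bsup>k\<^esup>. \<phi> S = i"
      using dense by blast
    then have "e \<in> E" using nsets_mono[OF AN] unfolding E_def labelled_edges_def by blast
    moreover have "e \<subseteq> A" using e(1) by (simp add: nsets_def)
    ultimately show False using A(1) by (simp add: independent_set_def)
  qed
  with c show ?thesis by (intro exI[of _ c] conjI exI[of _ r] allI impI)
qed

end
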